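(* Let $T:F^*\to G^*$ be a natural transformation between two contravariant functors on $\mathscr C$. Suppose that the elements $c^T\in\mathbb B^{coop}G^i(X\to Y)$ associated to the elements $c\in\mathbb B^{coop}_TF^i(X\to Y)$ (as in the definition of $\mathbb B^{coop}_TF^*$) satisfy the following three properties (if $T$ is surjective, i.e. $T:F^*(W)\to G^*(W)$ is surjective for every object $W$, they are automatically satisfied): 1. $(c\bullet d)^T=c^T\bullet d^T$, 2. $(f_*c)^T=f_*(c^T)$, 3. $(g^*c)^T=g^*(c^T)$. Then there is a Grothendieck transformation $$\gamma_T:\mathbb B^{coop}_TF^*\to\mathbb B^{coop}G^*,$$ which is the collection of the maps $\gamma_T:\mathbb B^{coop}_TF^*(X\xrightarrow{f}Y)\to\mathbb B^{coop}G^*(X\xrightarrow{f}Y)$ defined by $\gamma_T(c):=c^T$ for each $c\in\mathbb B^{coop}_TF^*(X\xrightarrow{f}Y)$. Furthermore, $\gamma_T(c)=c^T$ means that for all $m\in\mathbb Z$ and all $g:Y'\to Y$, with $X'=X\times_YY'$, $$T\circ c_g=(c^T)_g\circ T:F^m(X')\to G^{m+i}(Y')$$ for $c\in\mathbb B^{coop}_TF^i(X\xrightarrow{f}Y)$.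
   Context: $\mathscr C$ is a category with a final object and fiber products, in which all fiber squares are independent. Contravariant functors take graded values, $F^*(X)=\{F^m(X)\}_{m\in\mathbb Z}$, with degree-preserving pullbacks $h^*$; natural transformations preserve degree. Co-operational classes are collections of maps (not necessarily homomorphisms), and co-operational theories are regarded as (graded) sets. Co-operational bivariant theory $\mathbb B^{coop}F^*$ of a contravariant functor $F^*$. For $f:X\to Y$, an element $c\in\mathbb B^{coop}F^i(X\xrightarrow{f}Y)$ is a collection of maps $c_g:F^m(X')\to F^{m+i}(Y')$ for all $m\in\mathbb Z$ and all $g:Y'\to Y$ (where $X'=X\times_YY'$), such that for all $h:Y''\to Y'$, with $X''=X'\times_{Y'}Y''$ and projection $h':X''\to X'$, one has $c_{g\circ h}\circ(h')^*=h^*\circ c_g$. The operations are: - Product, for $c\in\mathbb B^{coop}F^i(X\xrightarrow{f}Y)$, $d\in\mathbb B^{coop}F^j(Y\xrightarrow{g}Z)$: $(c\bullet d)_h:=d_h\circ c_{h'}$ for $h:Z'\to Z$, where $h':Y'=Y\times_ZZ'\to Y$ is the projection. - Pushforward, for $X\xrightarrow{f}Y\xrightarrow{g}Z$ and $c\in\mathbb B^{coop}F^i(X\xrightarrow{g\circ f}Z)$: $(f_*c)_h:=c_h\circ(f')^*$ for $h:Z'\to Z$, where $f':X'\to Y'$ is the base change of $f$ along $Y'=Y\times_ZZ'\to Y$. - Pullback, for $c\in\mathbb B^{coop}F^i(X\xrightarrow{f}Y)$ and $g:Y'\to Y$: $g^*c\in\mathbb B^{coop}F^i(X'\xrightarrow{f'}Y')$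 with $(g^*c)_h:=c_{g\circ h}$ for $h:Y''\to Y'$. The subtheory $\mathbb B^{coop}_TF^*$. $\mathbb B^{coop}_TF^i(X\xrightarrow{f}Y)\subset\mathbb B^{coop}F^i(X\xrightarrow{f}Y)$ consists of those $c$ for which there exists an element $c^T\in\mathbb B^{coop}G^i(X\xrightarrow{f}Y)$ such that $T\circ c_g=(c^T)_g\circ T:F^m(X')\to G^{m+i}(Y')$ for all $m\in\mathbb Z$ and all $g:Y'\to Y$. It is closed under the product, pushforward and pullback of $\mathbb B^{coop}F^*$. For each $c$ in it, $c^T$ denotes the chosen such element. A Grothendieck transformation $\gamma:\mathbb B\to\mathbb B'$ is a collection of maps $\mathbb B(X\to Y)\to\mathbb B'(X\to Y)$, one for each morphism $X\to Y$, preserving product, pushforward and pullback: $\gamma(\alpha\bullet\beta)=\gamma(\alpha)\bullet\gamma(\beta)$, $\gamma(f_*\alpha)=f_*\gamma(\alpha)$, $\gamma(g^*\alpha)=g^*\gamma(\alpha)$. *)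

theory Defs
  imports "HOL-Library.FuncSet"
begin

text \<open>\<^term>\<open>P1 C f g\<close> and \<^term>\<open>P2 C f g\<close> are the two projections of a chosen fiber product of
  \<open>f : X \<rightarrow> Y\<close> and \<open>g : Y' \<rightarrow> Y\<close>; the object \<open>X \<times>\<^sub>Y Y'\<close> itself is their common domain.\<close>

record ('o, 'a) category_data =
  Ob :: "'o set"
  Ar :: "'a set"
  Dom :: "'a \<Rightarrow> 'o"
  Cod :: "'a \<Rightarrow> 'o"
  Idn :: "'o \<Rightarrow> 'a"
  Cmp :: "'a \<Rightarrow> 'a \<Rightarrow> 'a"  (infixr "\<cdot>\<index>" 75)
  P1 :: "'a \<Rightarrow> 'a \<Rightarrow> 'a"
  P2 :: "'a \<Rightarrow> 'a \<Rightarrow> 'a"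

definition FP :: "('o, 'a) category_data \<Rightarrow> 'a \<Rightarrow> 'a \<Rightarrow> 'o" where
  "FP C f g = Dom C (P1 C f g)"

locale is_category =
  fixes C :: "('o, 'a) category_data" (structure)
  assumes Dom_Ob: "f \<in> Ar C \<Longrightarrow> Dom C f \<in> Ob C"
    and Cod_Ob: "f \<in> Ar C \<Longrightarrow> Cod C f \<in> Ob C"
    and Idn_Ar: "X \<in> Ob C \<Longrightarrow> Idn C X \<in> Ar C"
    and Dom_Idn: "X \<in> Ob C \<Longrightarrow> Dom C (Idn C X) = X"
    and Cod_Idn: "X \<in> Ob C \<Longrightarrow> Cod C (Idn C X) = X"
    and Cmp_Ar: "\<lbrakk>f \<in> Ar C; g \<in> Ar C; Cod C f = Dom C g\<rbrakk> \<Longrightarrow> g \<cdot> f \<in> Ar C"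
    and Dom_Cmp: "\<lbrakk>f \<in> Ar C; g \<in> Ar C; Cod C f = Dom C g\<rbrakk> \<Longrightarrow> Dom C (g \<cdot> f) = Dom C f"
    and Cod_Cmp: "\<lbrakk>f \<in> Ar C; g \<in> Ar C; Cod C f = Dom C g\<rbrakk> \<Longrightarrow> Cod C (g \<cdot> f) = Cod C g"
    and Idn_right: "f \<in> Ar C \<Longrightarrow> f \<cdot> Idn C (Dom C f) = f"
    and Idn_left: "f \<in> Ar C \<Longrightarrow> Idn C (Cod C f) \<cdot> f = f"
    and Cmp_assoc: "\<lbrakk>f \<in> Ar C; g \<in> Ar C; h \<in> Ar C; Cod C f = Dom C g; Cod C g = Dom C h\<rbrakk>
      \<Longrightarrow> (h \<cdot> g) \<cdot> f = h \<cdot> (g \<cdot> f)"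

definition final_object :: "('o, 'a) category_data \<Rightarrow> 'o \<Rightarrow> bool" where
  "final_object C t \<longleftrightarrow>
     t \<in> Ob C \<and> (\<forall>X\<in>Ob C. \<exists>!u. u \<in> Ar C \<and> Dom C u = X \<and> Cod C u = t)"

text \<open>\<open>fiber_square C g' f' f g\<close> says that the following square is cartesian:
  \<open>f' : X' \<rightarrow> Y'\<close> on top of \<open>f : X \<rightarrow> Y\<close>, with \<open>g' : X' \<rightarrow> X\<close> and \<open>g : Y' \<rightarrow> Y\<close>.\<close>

definition fiber_square :: "('o, 'a) category_data \<Rightarrow> 'a \<Rightarrow> 'a \<Rightarrow> 'a \<Rightarrow> 'a \<Rightarrow> bool" where
  "fiber_square C g' f' f g \<longleftrightarrow>
     g' \<in> Ar C \<and> f' \<in> Ar C \<and> f \<in> Ar C \<and> g \<in> Ar C \<and>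
     Dom C g' = Dom C f' \<and> Cod C g' = Dom C f \<and> Cod C f' = Dom C g \<and> Cod C f = Cod C g \<and>
     f \<cdot>\<^bsub>C\<^esub> g' = g \<cdot>\<^bsub>C\<^esub> f' \<and>
     (\<forall>a\<in>Ar C. \<forall>b\<in>Ar C.
        Dom C a = Dom C b \<and> Cod C a = Dom C f \<and> Cod C b = Dom C g \<and> f \<cdot>\<^bsub>C\<^esub> a = g \<cdot>\<^bsub>C\<^esub> b \<longrightarrow>
        (\<exists>!u. u \<in> Ar C \<and> Dom C u = Dom C a \<and> Cod C u = Dom C g' \<and> g' \<cdot>\<^bsub>C\<^esub> u = a \<and> f' \<cdot>\<^bsub>C\<^esub> u = b))"

text \<open>The morphism into the apex of a fiber square with legs \<open>g'\<close>, \<open>f'\<close> whose components are \<open>a\<close>, \<open>b\<close>.\<close>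

definition induced :: "('o, 'a) category_data \<Rightarrow> 'a \<Rightarrow> 'a \<Rightarrow> 'a \<Rightarrow> 'a \<Rightarrow> 'a" where
  "induced C g' f' a b =
     (THE u. u \<in> Ar C \<and> Dom C u = Dom C a \<and> Cod C u = Dom C g' \<and> g' \<cdot>\<^bsub>C\<^esub> u = a \<and> f' \<cdot>\<^bsub>C\<^esub> u = b)"

locale fp_category = is_category +
  assumes ex_final: "\<exists>t. final_object C t"
    and fiber_product:
      "\<lbrakk>f \<in> Ar C; g \<in> Ar C; Cod C f = Cod C g\<rbrakk> \<Longrightarrow> fiber_square C (P1 C f g) (P2 C f g) f g"

text \<open>\<^term>\<open>Val F X m\<close> is the set \<open>F\<^sup>m(X)\<close> and \<^term>\<open>Pb F h m\<close> is
  \<open>h\<^sup>* : F\<^sup>m(Cod h) \<rightarrow> F\<^sup>m(Dom h)\<close>.  All values are subsets of one type; only their elements matter, so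
  functions on them are compared on their domains.\<close>

record ('o, 'a, 'v) functor_data =
  Val :: "'o \<Rightarrow> int \<Rightarrow> 'v set"
  Pb :: "'a \<Rightarrow> int \<Rightarrow> 'v \<Rightarrow> 'v"

locale contravariant_functor =
  fixes C :: "('o, 'a) category_data" (structure) and F :: "('o, 'a, 'v) functor_data"
  assumes Pb_in: "h \<in> Ar C \<Longrightarrow> Pb F h m \<in> Val F (Cod C h) m \<rightarrow> Val F (Dom C h) m"
    and Pb_Idn: "\<lbrakk>X \<in> Ob C; x \<in> Val F X m\<rbrakk> \<Longrightarrow> Pb F (Idn C X) m x = x"
    and Pb_Cmp: "\<lbrakk>h \<in> Ar C; k \<in> Ar C; Cod C h = Dom C k; x \<in> Val F (Cod C k) m\<rbrakk>
      \<Longrightarrow> Pb F (k \<cdot> h) m x = Pb F h m (Pb F k m x)"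

definition natural_transformation ::
  "('o, 'a) category_data \<Rightarrow> ('o, 'a, 'v) functor_data \<Rightarrow> ('o, 'a, 'w) functor_data
    \<Rightarrow> ('o \<Rightarrow> int \<Rightarrow> 'v \<Rightarrow> 'w) \<Rightarrow> bool" where
  "natural_transformation C F G T \<longleftrightarrow>
     (\<forall>X\<in>Ob C. \<forall>m. T X m \<in> Val F X m \<rightarrow> Val G X m) \<and>
     (\<forall>h\<in>Ar C. \<forall>m. \<forall>x\<in>Val F (Cod C h) m.
        T (Dom C h) m (Pb F h m x) = Pb G h m (T (Cod C h) m x))"

definition surjective_transformation ::
  "('o, 'a) category_data \<Rightarrow> ('o, 'a, 'v) functor_data \<Rightarrow> ('o, 'a, 'w) functor_data
    \<Rightarrow> ('o \<Rightarrow> int \<Rightarrow> 'v \<Rightarrow> 'w) \<Rightarrow> bool" where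
  "surjective_transformation C F G T \<longleftrightarrow> (\<forall>W\<in>Ob C. \<forall>m. T W m ` Val F W m = Val G W m)"

text \<open>A class on \<open>f : X \<rightarrow> Y\<close> sends \<open>g : Y' \<rightarrow> Y\<close> and a degree \<open>m\<close> to a map
  \<open>c\<^sub>g : F\<^sup>m(X \<times>\<^sub>Y Y') \<rightarrow> F\<^sup>m\<^sup>+\<^sup>i(Y')\<close>.  It is extensional in every argument, so that equality of classes is
  equality of collections of maps.\<close>

type_synonym ('a, 'v) coop_class = "'a \<Rightarrow> int \<Rightarrow> 'v \<Rightarrow> 'v"

definition Over :: "('o, 'a) category_data \<Rightarrow> 'a \<Rightarrow> 'a set" where
  "Over C f = {g \<in> Ar C. Cod C g = Cod C f}"

text \<open>The projection \<open>h' : X \<times>\<^sub>Y Y'' \<rightarrow> X \<times>\<^sub>Y Y'\<close>, the base change of \<open>h : Y'' \<rightarrow> Y'\<close>.  Its source, formed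
  over the composite \<open>g \<circ> h\<close>, is a fiber product of \<open>X' = X \<times>\<^sub>Y Y'\<close> and \<open>Y''\<close> over \<open>Y'\<close> with projections
  \<open>h'\<close> and \<^term>\<open>P2 C f (g \<cdot>\<^bsub>C\<^esub> h)\<close>; see \<open>fiber_square_base_change\<close> below.\<close>

definition base_change :: "('o, 'a) category_data \<Rightarrow> 'a \<Rightarrow> 'a \<Rightarrow> 'a \<Rightarrow> 'a" where
  "base_change C f g h =
     induced C (P1 C f g) (P2 C f g) (P1 C f (g \<cdot>\<^bsub>C\<^esub> h)) (h \<cdot>\<^bsub>C\<^esub> P2 C f (g \<cdot>\<^bsub>C\<^esub> h))"

definition coop ::
  "('o, 'a) category_data \<Rightarrow> ('o, 'a, 'v) functor_data \<Rightarrow> int \<Rightarrow> 'a \<Rightarrow> ('a, 'v) coop_class set" where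
  "coop C F i f =
     {c \<in> (\<Pi>\<^sub>E g\<in>Over C f. \<Pi>\<^sub>E m\<in>UNIV. Val F (FP C f g) m \<rightarrow>\<^sub>E Val F (Dom C g) (m + i)).
        \<forall>g\<in>Over C f. \<forall>h\<in>Ar C. Cod C h = Dom C g \<longrightarrow>
          (\<forall>m. \<forall>x\<in>Val F (FP C f g) m.
             c (g \<cdot>\<^bsub>C\<^esub> h) m (Pb F (base_change C f g h) m x) = Pb F h (m + i) (c g m x))}"

text \<open>In the product, \<open>h' = P1 C g h : Y \<times>\<^sub>Z Z' \<rightarrow> Y\<close> and \<^term>\<open>c (P1 C g h) m\<close> starts at
  \<open>X \<times>\<^sub>Y (Y \<times>\<^sub>Z Z')\<close>.  The \<open>induced\<close> morphism is the canonical isomorphism from this object to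
  \<open>X \<times>\<^sub>Z Z'\<close>, where the product class has to start.\<close>

definition coop_prod ::
  "('o, 'a) category_data \<Rightarrow> ('o, 'a, 'v) functor_data \<Rightarrow> int \<Rightarrow> 'a \<Rightarrow> 'a
    \<Rightarrow> ('a, 'v) coop_class \<Rightarrow> ('a, 'v) coop_class \<Rightarrow> ('a, 'v) coop_class" where
  "coop_prod C F i f g c d =
     (\<lambda>h\<in>Over C g. \<lambda>m\<in>UNIV. \<lambda>x\<in>Val F (FP C (g \<cdot>\<^bsub>C\<^esub> f) h) m.
        d h (m + i) (c (P1 C g h) m
          (Pb F (induced C (P1 C (g \<cdot>\<^bsub>C\<^esub> f) h) (P2 C (g \<cdot>\<^bsub>C\<^esub> f) h)
                   (P1 C f (P1 C g h)) (P2 C g h \<cdot>\<^bsub>C\<^esub> P2 C f (P1 C g h))) m x)))"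

text \<open>In the pushforward, the \<open>induced\<close> morphism is \<open>f' : X \<times>\<^sub>Z Z' \<rightarrow> Y \<times>\<^sub>Z Z'\<close>, the base change of \<open>f\<close>.\<close>

definition coop_push ::
  "('o, 'a) category_data \<Rightarrow> ('o, 'a, 'v) functor_data \<Rightarrow> 'a \<Rightarrow> 'a
    \<Rightarrow> ('a, 'v) coop_class \<Rightarrow> ('a, 'v) coop_class" where
  "coop_push C F f g c =
     (\<lambda>h\<in>Over C g. \<lambda>m\<in>UNIV. \<lambda>x\<in>Val F (FP C g h) m.
        c h m (Pb F (induced C (P1 C g h) (P2 C g h) (f \<cdot>\<^bsub>C\<^esub> P1 C (g \<cdot>\<^bsub>C\<^esub> f) h) (P2 C (g \<cdot>\<^bsub>C\<^esub> f) h)) m x))"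

text \<open>The pullback is defined along every fiber square, not only along the chosen ones, since all fiber
  squares are independent.  The \<open>induced\<close> morphism is the canonical isomorphism
  \<open>X \<times>\<^sub>Y Y'' \<rightarrow> X' \<times>\<^sub>Y\<^sub>' Y''\<close>; pulling back along it leads from \<open>F\<^sup>m(X' \<times>\<^sub>Y\<^sub>' Y'')\<close> to the source of
  \<^term>\<open>c (g \<cdot>\<^bsub>C\<^esub> h) m\<close>.\<close>

definition coop_pull ::
  "('o, 'a) category_data \<Rightarrow> ('o, 'a, 'v) functor_data \<Rightarrow> 'a \<Rightarrow> 'a \<Rightarrow> 'a \<Rightarrow> 'a
    \<Rightarrow> ('a, 'v) coop_class \<Rightarrow> ('a, 'v) coop_class" where
  "coop_pull C F g' f' f g c =
     (\<lambda>h\<in>Over C f'. \<lambda>m\<in>UNIV. \<lambda>x\<in>Val F (FP C f' h) m.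
        c (g \<cdot>\<^bsub>C\<^esub> h) m
          (Pb F (induced C (g' \<cdot>\<^bsub>C\<^esub> P1 C f' h) (P2 C f' h) (P1 C f (g \<cdot>\<^bsub>C\<^esub> h)) (P2 C f (g \<cdot>\<^bsub>C\<^esub> h))) m x))"

definition intertwines ::
  "('o, 'a) category_data \<Rightarrow> ('o, 'a, 'v) functor_data \<Rightarrow> ('o \<Rightarrow> int \<Rightarrow> 'v \<Rightarrow> 'w) \<Rightarrow> int \<Rightarrow> 'a
    \<Rightarrow> ('a, 'v) coop_class \<Rightarrow> ('a, 'w) coop_class \<Rightarrow> bool" where
  "intertwines C F T i f c c' \<longleftrightarrow>
     (\<forall>g\<in>Over C f. \<forall>m. \<forall>x\<in>Val F (FP C f g) m.
        T (Dom C g) (m + i) (c g m x) = c' g m (T (FP C f g) m x))"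

definition coop_sub ::
  "('o, 'a) category_data \<Rightarrow> ('o, 'a, 'v) functor_data \<Rightarrow> ('o, 'a, 'w) functor_data
    \<Rightarrow> ('o \<Rightarrow> int \<Rightarrow> 'v \<Rightarrow> 'w) \<Rightarrow> int \<Rightarrow> 'a \<Rightarrow> ('a, 'v) coop_class set" where
  "coop_sub C F G T i f = {c \<in> coop C F i f. \<exists>c'\<in>coop C G i f. intertwines C F T i f c c'}"

text \<open>A choice of an element \<open>c\<^sup>T\<close> for each \<open>c\<close>.  The choice depends on the degree and the morphism as
  well, because the same function may represent classes in several degrees.\<close>

definition associated_choice ::
  "('o, 'a) category_data \<Rightarrow> ('o, 'a, 'v) functor_data \<Rightarrow> ('o, 'a, 'w) functor_data
    \<Rightarrow> ('o \<Rightarrow> int \<Rightarrow> 'v \<Rightarrow> 'w)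
    \<Rightarrow> (int \<Rightarrow> 'a \<Rightarrow> ('a, 'v) coop_class \<Rightarrow> ('a, 'w) coop_class) \<Rightarrow> bool" where
  "associated_choice C F G T cT \<longleftrightarrow>
     (\<forall>f\<in>Ar C. \<forall>i. \<forall>c\<in>coop_sub C F G T i f.
        cT i f c \<in> coop C G i f \<and> intertwines C F T i f c (cT i f c))"

definition choice_prod ::
  "('o, 'a) category_data \<Rightarrow> ('o, 'a, 'v) functor_data \<Rightarrow> ('o, 'a, 'w) functor_data
    \<Rightarrow> ('o \<Rightarrow> int \<Rightarrow> 'v \<Rightarrow> 'w)
    \<Rightarrow> (int \<Rightarrow> 'a \<Rightarrow> ('a, 'v) coop_class \<Rightarrow> ('a, 'w) coop_class) \<Rightarrow> bool" where
  "choice_prod C F G T cT \<longleftrightarrow>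
     (\<forall>f\<in>Ar C. \<forall>g\<in>Ar C. Cod C f = Dom C g \<longrightarrow>
       (\<forall>i j. \<forall>c\<in>coop_sub C F G T i f. \<forall>d\<in>coop_sub C F G T j g.
          cT (i + j) (g \<cdot>\<^bsub>C\<^esub> f) (coop_prod C F i f g c d)
            = coop_prod C G i f g (cT i f c) (cT j g d)))"

definition choice_push ::
  "('o, 'a) category_data \<Rightarrow> ('o, 'a, 'v) functor_data \<Rightarrow> ('o, 'a, 'w) functor_data
    \<Rightarrow> ('o \<Rightarrow> int \<Rightarrow> 'v \<Rightarrow> 'w)
    \<Rightarrow> (int \<Rightarrow> 'a \<Rightarrow> ('a, 'v) coop_class \<Rightarrow> ('a, 'w) coop_class) \<Rightarrow> bool" where
  "choice_push C F G T cT \<longleftrightarrow>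
     (\<forall>f\<in>Ar C. \<forall>g\<in>Ar C. Cod C f = Dom C g \<longrightarrow>
       (\<forall>i. \<forall>c\<in>coop_sub C F G T i (g \<cdot>\<^bsub>C\<^esub> f).
          cT i g (coop_push C F f g c) = coop_push C G f g (cT i (g \<cdot>\<^bsub>C\<^esub> f) c)))"

definition choice_pull ::
  "('o, 'a) category_data \<Rightarrow> ('o, 'a, 'v) functor_data \<Rightarrow> ('o, 'a, 'w) functor_data
    \<Rightarrow> ('o \<Rightarrow> int \<Rightarrow> 'v \<Rightarrow> 'w)
    \<Rightarrow> (int \<Rightarrow> 'a \<Rightarrow> ('a, 'v) coop_class \<Rightarrow> ('a, 'w) coop_class) \<Rightarrow> bool" where
  "choice_pull C F G T cT \<longleftrightarrow>
     (\<forall>g' f' f g. fiber_square C g' f' f g \<longrightarrow>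
       (\<forall>i. \<forall>c\<in>coop_sub C F G T i f.
          cT i f' (coop_pull C F g' f' f g c) = coop_pull C G g' f' f g (cT i f c)))"

text \<open>The theories are graded sets \<open>\<B>\<^sup>i(f)\<close>.  Every morphism admits pushforward, and every fiber square
  admits pullback.  The operations take the degrees and morphisms they refer to as arguments:
  \<open>Prod i j f g\<close> is \<open>\<bullet> : \<B>\<^sup>i(f) \<times> \<B>\<^sup>j(g) \<rightarrow> \<B>\<^sup>i\<^sup>+\<^sup>j(g \<circ> f)\<close>, \<open>Push i f g\<close> is
  \<open>f\<^sub>* : \<B>\<^sup>i(g \<circ> f) \<rightarrow> \<B>\<^sup>i(g)\<close>, and \<open>Pull i g' f' f g\<close> is \<open>g\<^sup>* : \<B>\<^sup>i(f) \<rightarrow> \<B>\<^sup>i(f')\<close>.\<close>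

record ('a, 'b) bivariant_data =
  Biv :: "int \<Rightarrow> 'a \<Rightarrow> 'b set"
  Prod :: "int \<Rightarrow> int \<Rightarrow> 'a \<Rightarrow> 'a \<Rightarrow> 'b \<Rightarrow> 'b \<Rightarrow> 'b"
  Push :: "int \<Rightarrow> 'a \<Rightarrow> 'a \<Rightarrow> 'b \<Rightarrow> 'b"
  Pull :: "int \<Rightarrow> 'a \<Rightarrow> 'a \<Rightarrow> 'a \<Rightarrow> 'a \<Rightarrow> 'b \<Rightarrow> 'b"

definition closed_operations :: "('o, 'a) category_data \<Rightarrow> ('a, 'b) bivariant_data \<Rightarrow> bool" where
  "closed_operations C B \<longleftrightarrow>
     (\<forall>f\<in>Ar C. \<forall>g\<in>Ar C. Cod C f = Dom C g \<longrightarrow>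
        (\<forall>i j. \<forall>a\<in>Biv B i f. \<forall>b\<in>Biv B j g. Prod B i j f g a b \<in> Biv B (i + j) (g \<cdot>\<^bsub>C\<^esub> f)) \<and>
        (\<forall>i. \<forall>a\<in>Biv B i (g \<cdot>\<^bsub>C\<^esub> f). Push B i f g a \<in> Biv B i g)) \<and>
     (\<forall>g' f' f g. fiber_square C g' f' f g \<longrightarrow>
        (\<forall>i. \<forall>a\<in>Biv B i f. Pull B i g' f' f g a \<in> Biv B i f'))"

definition grothendieck_transformation ::
  "('o, 'a) category_data \<Rightarrow> ('a, 'b) bivariant_data \<Rightarrow> ('a, 'c) bivariant_data
    \<Rightarrow> (int \<Rightarrow> 'a \<Rightarrow> 'b \<Rightarrow> 'c) \<Rightarrow> bool" where
  "grothendieck_transformation C B B' \<gamma> \<longleftrightarrow>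
     closed_operations C B \<and> closed_operations C B' \<and>
     (\<forall>f\<in>Ar C. \<forall>i. \<gamma> i f \<in> Biv B i f \<rightarrow> Biv B' i f) \<and>
     (\<forall>f\<in>Ar C. \<forall>g\<in>Ar C. Cod C f = Dom C g \<longrightarrow>
        (\<forall>i j. \<forall>a\<in>Biv B i f. \<forall>b\<in>Biv B j g.
           \<gamma> (i + j) (g \<cdot>\<^bsub>C\<^esub> f) (Prod B i j f g a b) = Prod B' i j f g (\<gamma> i f a) (\<gamma> j g b)) \<and>
        (\<forall>i. \<forall>a\<in>Biv B i (g \<cdot>\<^bsub>C\<^esub> f).
           \<gamma> i g (Push B i f g a) = Push B' i f g (\<gamma> i (g \<cdot>\<^bsub>C\<^esub> f) a))) \<and>
     (\<forall>g' f' f g. fiber_square C g' f' f g \<longrightarrow>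
        (\<forall>i. \<forall>a\<in>Biv B i f. \<gamma> i f' (Pull B i g' f' f g a) = Pull B' i g' f' f g (\<gamma> i f a)))"

definition coop_theory ::
  "('o, 'a) category_data \<Rightarrow> ('o, 'a, 'v) functor_data \<Rightarrow> ('a, ('a, 'v) coop_class) bivariant_data" where
  "coop_theory C F =
     \<lparr>Biv = coop C F,
      Prod = \<lambda>i j f g. coop_prod C F i f g,
      Push = \<lambda>i f g. coop_push C F f g,
      Pull = \<lambda>i g' f' f g. coop_pull C F g' f' f g\<rparr>"

definition coop_sub_theory ::
  "('o, 'a) category_data \<Rightarrow> ('o, 'a, 'v) functor_data \<Rightarrow> ('o, 'a, 'w) functor_data
    \<Rightarrow> ('o \<Rightarrow> int \<Rightarrow> 'v \<Rightarrow> 'w) \<Rightarrow> ('a, ('a, 'v) coop_class) bivariant_data" where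
  "coop_sub_theory C F G T = (coop_theory C F)\<lparr>Biv := coop_sub C F G T\<rparr>"

context is_category
begin

lemma fiber_squareD:
  assumes "fiber_square C g' f' f g"
  shows "g' \<in> Ar C" "f' \<in> Ar C" "f \<in> Ar C" "g \<in> Ar C" "Dom C g' = Dom C f'"
    "Cod C g' = Dom C f" "Cod C f' = Dom C g" "Cod C f = Cod C g" "f \<cdot> g' = g \<cdot> f'"
  using assms unfolding fiber_square_def by auto

lemma fiber_squareI:
  assumes "g' \<in> Ar C" "f' \<in> Ar C" "f \<in> Ar C" "g \<in> Ar C" "Dom C g' = Dom C f'"
    "Cod C g' = Dom C f" "Cod C f' = Dom C g" "Cod C f = Cod C g" "f \<cdot> g' = g \<cdot> f'"
    "\<And>a b. \<lbrakk>a \<in> Ar C; b \<in> Ar C; Dom C a = Dom C b; Cod C a = Dom C f; Cod C b = Dom C g;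
       f \<cdot> a = g \<cdot> b\<rbrakk> \<Longrightarrow>
       \<exists>!u. u \<in> Ar C \<and> Dom C u = Dom C a \<and> Cod C u = Dom C g' \<and> g' \<cdot> u = a \<and> f' \<cdot> u = b"
  shows "fiber_square C g' f' f g"
  unfolding fiber_square_def using assms by (intro conjI ballI impI; (elim conjE)?) assumption+

lemma fiber_square_ex1:
  assumes "fiber_square C g' f' f g" "a \<in> Ar C" "b \<in> Ar C" "Dom C a = Dom C b"
    "Cod C a = Dom C f" "Cod C b = Dom C g" "f \<cdot> a = g \<cdot> b"
  shows "\<exists>!u. u \<in> Ar C \<and> Dom C u = Dom C a \<and> Cod C u = Dom C g' \<and> g' \<cdot> u = a \<and> f' \<cdot> u = b"
  using assms unfolding fiber_square_def by blast

lemma fiber_square_induced: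
  assumes sq: "fiber_square C g' f' f g"
    and ab: "a \<in> Ar C" "b \<in> Ar C" "Dom C a = Dom C b" "Cod C a = Dom C f" "Cod C b = Dom C g"
      "f \<cdot> a = g \<cdot> b"
  shows "induced C g' f' a b \<in> Ar C" "Dom C (induced C g' f' a b) = Dom C a"
    "Cod C (induced C g' f' a b) = Dom C g'"
    "g' \<cdot> induced C g' f' a b = a" "f' \<cdot> induced C g' f' a b = b"
proof -
  have "\<exists>!u. u \<in> Ar C \<and> Dom C u = Dom C a \<and> Cod C u = Dom C g' \<and> g' \<cdot> u = a \<and> f' \<cdot> u = b"
    by (rule fiber_square_ex1[OF sq ab])
  from theI'[OF this]
  show "induced C g' f' a b \<in> Ar C" "Dom C (induced C g' f' a b) = Dom C a"
    "Cod C (induced C g' f' a b) = Dom C g'"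
    "g' \<cdot> induced C g' f' a b = a" "f' \<cdot> induced C g' f' a b = b"
    unfolding induced_def by auto
qed

lemma fiber_square_cancel:
  assumes sq: "fiber_square C g' f' f g"
    and uv: "u \<in> Ar C" "v \<in> Ar C" "Dom C u = Dom C v" "Cod C u = Dom C g'" "Cod C v = Dom C g'"
      "g' \<cdot> u = g' \<cdot> v" "f' \<cdot> u = f' \<cdot> v"
  shows "u = v"
proof -
  note D = fiber_squareD[OF sq]
  have uf': "Cod C u = Dom C f'" using uv(4) D(5) by simp
  have eq: "f \<cdot> (g' \<cdot> u) = g \<cdot> (f' \<cdot> u)"
    using Cmp_assoc[OF uv(1) D(1,3) uv(4) D(6)] Cmp_assoc[OF uv(1) D(2,4) uf' D(7)] D(9) by simp
  have p: "g' \<cdot> u \<in> Ar C" "f' \<cdot> u \<in> Ar C" "Dom C (g' \<cdot> u) = Dom C (f' \<cdot> u)"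
    "Cod C (g' \<cdot> u) = Dom C f" "Cod C (f' \<cdot> u) = Dom C g" "Dom C (g' \<cdot> u) = Dom C u"
    using Cmp_Ar[OF uv(1) D(1) uv(4)] Cmp_Ar[OF uv(1) D(2) uf'] Dom_Cmp[OF uv(1) D(1) uv(4)]
      Dom_Cmp[OF uv(1) D(2) uf'] Cod_Cmp[OF uv(1) D(1) uv(4)] Cod_Cmp[OF uv(1) D(2) uf'] D(6,7)
    by simp_all
  from fiber_square_ex1[OF sq p(1-5) eq] show ?thesis
    by (rule ex1E) (metis uv p(6))
qed

text \<open>If the outer rectangle over \<open>g \<circ> h\<close> and the square over \<open>g\<close> are cartesian, then so is the square
  over \<open>h\<close>; and conversely.\<close>

lemma fiber_square_left:
  assumes sq: "fiber_square C g' f' f g" and out: "fiber_square C k f'' f (g \<cdot> h)"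
    and h: "h \<in> Ar C" "Cod C h = Dom C g"
    and h': "h' \<in> Ar C" "Dom C h' = Dom C f''" "Cod C h' = Dom C g'" "g' \<cdot> h' = k" "f' \<cdot> h' = h \<cdot> f''"
  shows "fiber_square C h' f'' f' h"
proof -
  note D = fiber_squareD[OF sq] and E = fiber_squareD[OF out]
  have Dgh: "Dom C (g \<cdot> h) = Dom C h" by (rule Dom_Cmp[OF h(1) D(4) h(2)])
  have f'': "Cod C f'' = Dom C h" using E(7) Dgh by simp
  have univ: "\<exists>!u. u \<in> Ar C \<and> Dom C u = Dom C a \<and> Cod C u = Dom C h' \<and> h' \<cdot> u = a \<and> f'' \<cdot> u = b"
    if ab: "a \<in> Ar C" "b \<in> Ar C" "Dom C a = Dom C b" "Cod C a = Dom C f'" "Cod C b = Dom C h"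
      "f' \<cdot> a = h \<cdot> b" for a b
  proof -
    have a': "Cod C a = Dom C g'" using ab(4) D(5) by simp
    have eq: "f \<cdot> (g' \<cdot> a) = (g \<cdot> h) \<cdot> b"
      using Cmp_assoc[OF ab(1) D(1,3) a' D(6)] Cmp_assoc[OF ab(1) D(2,4) ab(4) D(7)]
        Cmp_assoc[OF ab(2) h(1) D(4) ab(5) h(2)] D(9) ab(6) by simp
    have ga: "g' \<cdot> a \<in> Ar C" "Dom C (g' \<cdot> a) = Dom C a" "Cod C (g' \<cdot> a) = Dom C f"
      using Cmp_Ar[OF ab(1) D(1) a'] Dom_Cmp[OF ab(1) D(1) a'] Cod_Cmp[OF ab(1) D(1) a'] D(6)
      by simp_all
    define u where "u = induced C k f'' (g' \<cdot> a) b"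
    have "Dom C (g' \<cdot> a) = Dom C b" "Cod C b = Dom C (g \<cdot> h)" using ga(2) ab(3,5) Dgh by simp_all
    note I = fiber_square_induced[OF out ga(1) ab(2) this(1) ga(3) this(2) eq, folded u_def]
    have u: "Dom C u = Dom C a" "Cod C u = Dom C h'" "Cod C u = Dom C f''"
      using I(2,3) ga(2) h'(2) E(5) by simp_all
    have hu: "h' \<cdot> u \<in> Ar C" "Dom C (h' \<cdot> u) = Dom C a" "Cod C (h' \<cdot> u) = Dom C g'"
      using Cmp_Ar[OF I(1) h'(1) u(2)] Dom_Cmp[OF I(1) h'(1) u(2)] Cod_Cmp[OF I(1) h'(1) u(2)]
        u(1) h'(3) by simp_all
    have g'hu: "g' \<cdot> (h' \<cdot> u) = g' \<cdot> a"
      using Cmp_assoc[OF I(1) h'(1) D(1) u(2) h'(3)] h'(4) I(4) by simp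
    have h'3: "Cod C h' = Dom C f'" using h'(3) D(5) by simp
    have f'hu: "f' \<cdot> (h' \<cdot> u) = f' \<cdot> a"
      using Cmp_assoc[OF I(1) h'(1) D(2) u(2) h'3] Cmp_assoc[OF I(1) E(2) h(1) u(3) f''] h'(5) I(5)
        ab(6) by simp
    have "h' \<cdot> u = a"
      by (rule fiber_square_cancel[OF sq hu(1) ab(1) hu(2,3) a' g'hu f'hu])
    moreover have "v = u"
      if v: "v \<in> Ar C" "Dom C v = Dom C a" "Cod C v = Dom C h'" "h' \<cdot> v = a" "f'' \<cdot> v = b" for v
    proof (rule fiber_square_cancel[OF out v(1) I(1)])
      show "Dom C v = Dom C u" "Cod C v = Dom C k" "Cod C u = Dom C k"
        using v(2,3) u h'(2) E(5) by simp_all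
      show "k \<cdot> v = k \<cdot> u" using Cmp_assoc[OF v(1) h'(1) D(1) v(3) h'(3)] h'(4) v(4) I(4) by simp
      show "f'' \<cdot> v = f'' \<cdot> u" using v(5) I(5) by simp
    qed
    ultimately show ?thesis using I(1,5) u by (intro ex1I[of _ u]) blast+
  qed
  show ?thesis
  proof (rule fiber_squareI[OF h'(1) E(2) D(2) h(1) h'(2) _ f'' _ h'(5) univ])
    show "Cod C h' = Dom C f'" using h'(3) D(5) by simp
    show "Cod C f' = Cod C h" using D(7) h(2) by simp
  qed
qed

lemma fiber_square_paste:
  assumes sq: "fiber_square C g' f' f g" and sq2: "fiber_square C h' f'' f' h"
  shows "fiber_square C (g' \<cdot> h') f'' f (g \<cdot> h)"
proof -
  note D = fiber_squareD[OF sq] and E = fiber_squareD[OF sq2]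
  have hg: "Cod C h = Dom C g" using D(7) E(8) by simp
  have h'g': "Cod C h' = Dom C g'" using E(6) D(5) by simp
  have Dgh: "Dom C (g \<cdot> h) = Dom C h" "Cod C (g \<cdot> h) = Cod C g" "g \<cdot> h \<in> Ar C"
    by (rule Dom_Cmp[OF E(4) D(4) hg] Cod_Cmp[OF E(4) D(4) hg] Cmp_Ar[OF E(4) D(4) hg])+
  have gh': "g' \<cdot> h' \<in> Ar C" "Dom C (g' \<cdot> h') = Dom C h'" "Cod C (g' \<cdot> h') = Cod C g'"
    by (rule Dom_Cmp[OF E(1) D(1) h'g'] Cod_Cmp[OF E(1) D(1) h'g'] Cmp_Ar[OF E(1) D(1) h'g'])+
  have comm: "f \<cdot> (g' \<cdot> h') = (g \<cdot> h) \<cdot> f''"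
    using Cmp_assoc[OF E(1) D(1,3) h'g' D(6)] Cmp_assoc[OF E(1) D(2,4) E(6) D(7)]
      Cmp_assoc[OF E(2,4) D(4) E(7) hg] D(9) E(9) by simp
  have univ: "\<exists>!u. u \<in> Ar C \<and> Dom C u = Dom C a \<and> Cod C u = Dom C (g' \<cdot> h') \<and>
      (g' \<cdot> h') \<cdot> u = a \<and> f'' \<cdot> u = b"
    if ab: "a \<in> Ar C" "b \<in> Ar C" "Dom C a = Dom C b" "Cod C a = Dom C f"
      "Cod C b = Dom C (g \<cdot> h)" "f \<cdot> a = (g \<cdot> h) \<cdot> b" for a b
  proof -
    have bh: "Cod C b = Dom C h" using ab(5) Dgh(1) by simp
    have hb: "h \<cdot> b \<in> Ar C" "Dom C a = Dom C (h \<cdot> b)" "Cod C (h \<cdot> b) = Dom C g"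
      using Cmp_Ar[OF ab(2) E(4) bh] Dom_Cmp[OF ab(2) E(4) bh] Cod_Cmp[OF ab(2) E(4) bh] ab(3) hg
      by simp_all
    have eq: "f \<cdot> a = g \<cdot> (h \<cdot> b)" using ab(6) Cmp_assoc[OF ab(2) E(4) D(4) bh hg] by simp
    define w where "w = induced C g' f' a (h \<cdot> b)"
    note W = fiber_square_induced[OF sq ab(1) hb(1,2) ab(4) hb(3) eq, folded w_def]
    have w: "Dom C w = Dom C b" "Cod C w = Dom C f'" using W(2,3) ab(3) D(5) by simp_all
    define u where "u = induced C h' f'' w b"
    note U = fiber_square_induced[OF sq2 W(1) ab(2) w bh W(5), folded u_def]
    have "(g' \<cdot> h') \<cdot> u = a" using Cmp_assoc[OF U(1) E(1) D(1) U(3) h'g'] U(4) W(4) by simp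
    moreover have "v = u"
      if v: "v \<in> Ar C" "Dom C v = Dom C a" "Cod C v = Dom C (g' \<cdot> h')" "(g' \<cdot> h') \<cdot> v = a"
        "f'' \<cdot> v = b" for v
    proof -
      have v3: "Cod C v = Dom C h'" "Cod C v = Dom C f''" using v(3) gh'(2) E(5) by simp_all
      have hv: "h' \<cdot> v \<in> Ar C" "Dom C (h' \<cdot> v) = Dom C w" "Cod C (h' \<cdot> v) = Dom C g'"
        using Cmp_Ar[OF v(1) E(1) v3(1)] Dom_Cmp[OF v(1) E(1) v3(1)] Cod_Cmp[OF v(1) E(1) v3(1)]
          v(2) W(2) h'g' by simp_all
      have "g' \<cdot> (h' \<cdot> v) = g' \<cdot> w"
        using Cmp_assoc[OF v(1) E(1) D(1) v3(1) h'g'] v(4) W(4) by simp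
      moreover have "f' \<cdot> (h' \<cdot> v) = f' \<cdot> w"
        using Cmp_assoc[OF v(1) E(1,3) v3(1) E(6)] Cmp_assoc[OF v(1) E(2,4) v3(2) E(7)] E(9) v(5)
          W(5) by simp
      ultimately have "h' \<cdot> v = w" by (rule fiber_square_cancel[OF sq hv(1) W(1) hv(2,3) W(3)])
      then show ?thesis
        using v(2,5) U(2,4,5) W(2)
        by (intro fiber_square_cancel[OF sq2 v(1) U(1) _ v3(1) U(3)]) simp_all
    qed
    moreover have "Dom C u = Dom C a" "Cod C u = Dom C (g' \<cdot> h')"
      using U(2,3) W(2) gh'(2) by simp_all
    ultimately show ?thesis using U(1,5) by (intro ex1I[of _ u]) blast+
  qed
  show ?thesis
  proof (rule fiber_squareI[OF gh'(1) E(2) D(3) Dgh(3) _ _ _ _ comm univ])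
    show "Dom C (g' \<cdot> h') = Dom C f''" using gh'(2) E(5) by simp
    show "Cod C (g' \<cdot> h') = Dom C f" using gh'(3) D(6) by simp
    show "Cod C f'' = Dom C (g \<cdot> h)" using E(7) Dgh(1) by simp
    show "Cod C f = Cod C (g \<cdot> h)" using D(8) Dgh(2) by simp
  qed
qed

lemma fiber_square_swap:
  assumes "fiber_square C g' f' f g"
  shows "fiber_square C f' g' g f"
proof (rule fiber_squareI)
  note D = fiber_squareD[OF assms]
  show "f' \<in> Ar C" "g' \<in> Ar C" "g \<in> Ar C" "f \<in> Ar C" "Dom C f' = Dom C g'"
    "Cod C f' = Dom C g" "Cod C g' = Dom C f" "Cod C g = Cod C f" "g \<cdot> f' = f \<cdot> g'"
    by (fact D D(5,8,9)[symmetric])+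
  fix a b
  assume ab: "a \<in> Ar C" "b \<in> Ar C" "Dom C a = Dom C b" "Cod C a = Dom C g" "Cod C b = Dom C f"
    "g \<cdot> a = f \<cdot> b"
  have "\<exists>!u. u \<in> Ar C \<and> Dom C u = Dom C b \<and> Cod C u = Dom C g' \<and> g' \<cdot> u = b \<and> f' \<cdot> u = a"
    by (rule fiber_square_ex1[OF assms ab(2,1) ab(3)[symmetric] ab(5,4) ab(6)[symmetric]])
  then show "\<exists>!u. u \<in> Ar C \<and> Dom C u = Dom C a \<and> Cod C u = Dom C f' \<and> f' \<cdot> u = a \<and> g' \<cdot> u = b"
    unfolding ab(3) D(5) by (simp only: conj_ac)
qed

end

context fp_category
begin

lemma fiber_square_base_change:
  assumes "f \<in> Ar C" "g \<in> Over C f" "h \<in> Ar C" "Cod C h = Dom C g"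
  shows "fiber_square C (base_change C f g h) (P2 C f (g \<cdot> h)) (P2 C f g) h"
proof -
  have g: "g \<in> Ar C" "Cod C f = Cod C g" using assms(2) unfolding Over_def by auto
  have gh: "g \<cdot> h \<in> Ar C" "Cod C f = Cod C (g \<cdot> h)" "Dom C (g \<cdot> h) = Dom C h"
    using Cmp_Ar[OF assms(3) g(1) assms(4)] Cod_Cmp[OF assms(3) g(1) assms(4)]
      Dom_Cmp[OF assms(3) g(1) assms(4)] g(2) by simp_all
  note sq = fiber_product[OF assms(1) g] and out = fiber_product[OF assms(1) gh(1,2)]
  note E = fiber_squareD[OF out]
  have p: "Cod C (P2 C f (g \<cdot> h)) = Dom C h" using E(7) gh(3) by simp
  have hp: "h \<cdot> P2 C f (g \<cdot> h) \<in> Ar C" "Dom C (P1 C f (g \<cdot> h)) = Dom C (h \<cdot> P2 C f (g \<cdot> h))"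
    "Cod C (h \<cdot> P2 C f (g \<cdot> h)) = Dom C g"
    using Cmp_Ar[OF E(2) assms(3) p] Dom_Cmp[OF E(2) assms(3) p] Cod_Cmp[OF E(2) assms(3) p] E(5)
      assms(4) by simp_all
  have eq: "f \<cdot> P1 C f (g \<cdot> h) = g \<cdot> (h \<cdot> P2 C f (g \<cdot> h))"
    using Cmp_assoc[OF E(2) assms(3) g(1) p assms(4)] E(9) by simp
  note I = fiber_square_induced[OF sq E(1) hp(1,2) E(6) hp(3) eq, folded base_change_def]
  show ?thesis
    by (rule fiber_square_left[OF sq out assms(3,4) I(1) _ I(3,4,5)]) (use I(2) E(5) in simp)
qed

text \<open>The iterated fiber products that \<open>coop_prod\<close>, \<open>coop_push\<close> and \<open>coop_pull\<close> compare with
  chosen ones: \<open>X \<times>\<^sub>Y (Y \<times>\<^sub>Z Z')\<close> is a fiber product of \<open>X\<close> and \<open>Z'\<close> over \<open>Z\<close>; the morphism \<open>f'\<close> is a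
  base change of \<open>f\<close>; and \<open>X' \<times>\<^sub>Y\<^sub>' Y''\<close> is a fiber product of \<open>X\<close> and \<open>Y''\<close> over \<open>Y\<close>.\<close>

lemma fiber_square_prod:
  assumes "f \<in> Ar C" "g \<in> Ar C" "Cod C f = Dom C g" "h \<in> Over C g"
  shows "fiber_square C (P1 C f (P1 C g h)) (P2 C g h \<cdot> P2 C f (P1 C g h)) (g \<cdot> f) h"
proof -
  have h: "h \<in> Ar C" "Cod C g = Cod C h" using assms(4) unfolding Over_def by auto
  note sq = fiber_product[OF assms(2) h]
  have "P1 C g h \<in> Ar C" "Cod C f = Cod C (P1 C g h)"
    using fiber_squareD(1,6)[OF sq] assms(3) by simp_all
  note sq2 = fiber_product[OF assms(1) this]
  show ?thesis
    by (rule fiber_square_swap[OF fiber_square_paste[OF fiber_square_swap[OF sq] fiber_square_swap[OF sq2]]])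
qed

lemma fiber_square_push:
  assumes "f \<in> Ar C" "g \<in> Ar C" "Cod C f = Dom C g" "h \<in> Over C g"
  shows "fiber_square C (P1 C (g \<cdot> f) h)
    (induced C (P1 C g h) (P2 C g h) (f \<cdot> P1 C (g \<cdot> f) h) (P2 C (g \<cdot> f) h)) f (P1 C g h)"
proof -
  have h: "h \<in> Ar C" "Cod C g = Cod C h" using assms(4) unfolding Over_def by auto
  have gf: "g \<cdot> f \<in> Ar C" "Cod C (g \<cdot> f) = Cod C h" "Dom C (g \<cdot> f) = Dom C f"
    using Cmp_Ar[OF assms(1-3)] Cod_Cmp[OF assms(1-3)] Dom_Cmp[OF assms(1-3)] h(2) by simp_all
  note sq = fiber_product[OF assms(2) h] and out = fiber_product[OF gf(1) h(1) gf(2)]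
  note D = fiber_squareD[OF sq] and E = fiber_squareD[OF out]
  have p: "Cod C (P1 C (g \<cdot> f) h) = Dom C f" using E(6) gf(3) by simp
  have fp: "f \<cdot> P1 C (g \<cdot> f) h \<in> Ar C" "Dom C (f \<cdot> P1 C (g \<cdot> f) h) = Dom C (P2 C (g \<cdot> f) h)"
    "Dom C (f \<cdot> P1 C (g \<cdot> f) h) = Dom C (P1 C (g \<cdot> f) h)" "Cod C (f \<cdot> P1 C (g \<cdot> f) h) = Dom C g"
    using Cmp_Ar[OF E(1) assms(1) p] Dom_Cmp[OF E(1) assms(1) p] Cod_Cmp[OF E(1) assms(1) p] E(5)
      assms(3) by simp_all
  have eq: "g \<cdot> (f \<cdot> P1 C (g \<cdot> f) h) = h \<cdot> P2 C (g \<cdot> f) h"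
    using Cmp_assoc[OF E(1) assms(1,2) p assms(3)] E(9) by simp
  note I = fiber_square_induced[OF sq fp(1) E(2) fp(2,4) E(7) eq]
  show ?thesis
    by (rule fiber_square_swap[OF fiber_square_left[OF fiber_square_swap[OF sq]
          fiber_square_swap[OF out] assms(1,3) I(1) _ _ I(5,4)]])
      (use I(2,3) fp(3) D(5) in simp_all)
qed

lemma fiber_square_pull:
  assumes "fiber_square C g' f' f g" "h \<in> Over C f'"
  shows "fiber_square C (g' \<cdot> P1 C f' h) (P2 C f' h) f (g \<cdot> h)"
  using fiber_square_paste[OF assms(1) fiber_product] assms fiber_squareD(2)[OF assms(1)]
  unfolding Over_def by simp

end

end

theory Submission
  imports Defs
begin

text \<open>Each operation first pulls back along a morphism induced by the universal property of a fiber
  product (\<open>f'\<close> for the pushforward, a canonical isomorphism for product and pullback), and these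
  morphisms are compatible with base change.  Hence the compatibility of the given classes with
  pullbacks passes to the result of the operation, and by naturality of \<open>T\<close> so does the relation
  \<^const>\<open>intertwines\<close>.  If \<open>T\<close> is surjective, a class over \<open>G\<close> is determined by the class over \<open>F\<close>
  that it intertwines with, which forces the three compatibilities of \<open>c\<^sup>T\<close>.\<close>

section \<open>Named comparison morphisms and co-operational classes as extensional families of
  maps\<close>

definition prod_comparison :: "('o, 'a) category_data \<Rightarrow> 'a \<Rightarrow> 'a \<Rightarrow> 'a \<Rightarrow> 'a" where
  "prod_comparison C f g h =
     induced C (P1 C (g \<cdot>\<^bsub>C\<^esub> f) h) (P2 C (g \<cdot>\<^bsub>C\<^esub> f) h)
       (P1 C f (P1 C g h)) (P2 C g h \<cdot>\<^bsub>C\<^esub> P2 C f (P1 C g h))"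

text \<open>Unlike \<open>prod_comparison\<close> and \<open>pull_comparison\<close>, which relate
  two models of one fiber product, this is a base change of \<open>f\<close> and in general not
  invertible. The arguments below work with the projections of all these morphisms, so the three
  operations can be treated in parallel.\<close>

definition push_comparison :: "('o, 'a) category_data \<Rightarrow> 'a \<Rightarrow> 'a \<Rightarrow> 'a \<Rightarrow> 'a" where
  "push_comparison C f g h =
     induced C (P1 C g h) (P2 C g h) (f \<cdot>\<^bsub>C\<^esub> P1 C (g \<cdot>\<^bsub>C\<^esub> f) h) (P2 C (g \<cdot>\<^bsub>C\<^esub> f) h)"

definition pull_comparison :: "('o, 'a) category_data \<Rightarrow> 'a \<Rightarrow> 'a \<Rightarrow> 'a \<Rightarrow> 'a \<Rightarrow> 'a \<Rightarrow> 'a" where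
  "pull_comparison C g' f' f g h =
     induced C (g' \<cdot>\<^bsub>C\<^esub> P1 C f' h) (P2 C f' h) (P1 C f (g \<cdot>\<^bsub>C\<^esub> h)) (P2 C f (g \<cdot>\<^bsub>C\<^esub> h))"

lemma coop_prod_apply:
  assumes "h \<in> Over C g" "x \<in> Val F (FP C (g \<cdot>\<^bsub>C\<^esub> f) h) m"
  shows "coop_prod C F i f g c d h m x =
    d h (m + i) (c (P1 C g h) m (Pb F (prod_comparison C f g h) m x))"
  using assms unfolding coop_prod_def prod_comparison_def by simp

lemma coop_push_apply:
  assumes "h \<in> Over C g" "x \<in> Val F (FP C g h) m"
  shows "coop_push C F f g c h m x = c h m (Pb F (push_comparison C f g h) m x)"
  using assms unfolding coop_push_def push_comparison_def by simp

lemma coop_pull_apply: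
  assumes "h \<in> Over C f'" "x \<in> Val F (FP C f' h) m"
  shows "coop_pull C F g' f' f g c h m x =
    c (g \<cdot>\<^bsub>C\<^esub> h) m (Pb F (pull_comparison C g' f' f g h) m x)"
  using assms unfolding coop_pull_def pull_comparison_def by simp

lemma coopI:
  assumes "c \<in> (\<Pi>\<^sub>E g\<in>Over C f. \<Pi>\<^sub>E m\<in>UNIV. Val F (FP C f g) m \<rightarrow>\<^sub>E Val F (Dom C g) (m + i))"
    and "\<And>g h m x. \<lbrakk>g \<in> Over C f; h \<in> Ar C; Cod C h = Dom C g; x \<in> Val F (FP C f g) m\<rbrakk>
      \<Longrightarrow> c (g \<cdot>\<^bsub>C\<^esub> h) m (Pb F (base_change C f g h) m x) = Pb F h (m + i) (c g m x)"
  shows "c \<in> coop C F i f"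
  using assms unfolding coop_def by blast

lemma coop_value:
  assumes "c \<in> coop C F i f" "g \<in> Over C f" "x \<in> Val F (FP C f g) m"
  shows "c g m x \<in> Val F (Dom C g) (m + i)"
proof -
  have "c g \<in> (\<Pi>\<^sub>E m\<in>UNIV. Val F (FP C f g) m \<rightarrow>\<^sub>E Val F (Dom C g) (m + i))"
    using assms(1,2) unfolding coop_def by (auto dest: PiE_mem)
  then have "c g m \<in> Val F (FP C f g) m \<rightarrow>\<^sub>E Val F (Dom C g) (m + i)" by (rule PiE_mem) simp
  then show ?thesis using assms(3) by (rule PiE_mem)
qed

lemma coop_base_change:
  assumes "c \<in> coop C F i f" "g \<in> Over C f" "h \<in> Ar C" "Cod C h = Dom C g"
    "x \<in> Val F (FP C f g) m"
  shows "c (g \<cdot>\<^bsub>C\<^esub> h) m (Pb F (base_change C f g h) m x) = Pb F h (m + i) (c g m x)"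
  using assms unfolding coop_def by blast

text \<open>The nested \<open>\<Pi>\<^sub>E\<close> in \<open>coop\<close> fixes all values outside
  \<open>Over C f\<close> and outside the sets \<open>Val\<close>, so agreement at genuine arguments
  already forces equality. This turns pointwise uniqueness into uniqueness of a class.\<close>

lemma coop_ext:
  assumes "c \<in> coop C F i f" "d \<in> coop C F i f"
    and "\<And>g m x. \<lbrakk>g \<in> Over C f; x \<in> Val F (FP C f g) m\<rbrakk> \<Longrightarrow> c g m x = d g m x"
  shows "c = d"
proof (rule PiE_ext)
  show c: "c \<in> (\<Pi>\<^sub>E g\<in>Over C f. \<Pi>\<^sub>E m\<in>UNIV. Val F (FP C f g) m \<rightarrow>\<^sub>E Val F (Dom C g) (m + i))"
    and d: "d \<in> (\<Pi>\<^sub>E g\<in>Over C f. \<Pi>\<^sub>E m\<in>UNIV. Val F (FP C f g) m \<rightarrow>\<^sub>E Val F (Dom C g) (m + i))"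
    using assms(1,2) unfolding coop_def by blast+
  fix g assume g: "g \<in> Over C f"
  show "c g = d g"
  proof
    \<comment> \<open>The degree ranges over \<open>UNIV\<close>, so plain function extensionality
      handles this middle layer.\<close>
    fix m
    show "c g m = d g m"
      by (rule PiE_ext[OF PiE_mem[OF PiE_mem[OF c g] UNIV_I] PiE_mem[OF PiE_mem[OF d g] UNIV_I]
            assms(3)[OF g]])
  qed
qed

section \<open>Comparison morphisms and their compatibility with base change\<close>

context fp_category
begin

lemma P1_simps [simp]:
  assumes "f \<in> Ar C" "g \<in> Ar C" "Cod C g = Cod C f"
  shows "P1 C f g \<in> Ar C" "Dom C (P1 C f g) = FP C f g" "Cod C (P1 C f g) = Dom C f"
  using fiber_squareD[OF fiber_product[OF assms(1,2) assms(3)[symmetric]]]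
  unfolding FP_def by simp_all

lemma P2_simps [simp]:
  assumes "f \<in> Ar C" "g \<in> Ar C" "Cod C g = Cod C f"
  shows "P2 C f g \<in> Ar C" "Dom C (P2 C f g) = FP C f g" "Cod C (P2 C f g) = Dom C g"
  using fiber_squareD[OF fiber_product[OF assms(1,2) assms(3)[symmetric]]]
  unfolding FP_def by simp_all

lemma P1_P2_commute:
  assumes "f \<in> Ar C" "g \<in> Ar C" "Cod C g = Cod C f"
  shows "f \<cdot> P1 C f g = g \<cdot> P2 C f g"
  using fiber_squareD(9)[OF fiber_product[OF assms(1,2) assms(3)[symmetric]]] .

lemmas Cmp_simps = Cmp_Ar Dom_Cmp Cod_Cmp Cmp_assoc

text \<open>Rewriting with \<open>Cmp_assoc\<close> brackets composites to the right, which hides a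
  factor \<open>a \<cdot> b\<close> as soon as a tail \<open>u\<close> follows. Applied to a
  projection equation, this yields the form of it that still fires in front of a tail.\<close>

lemma Cmp_reassoc:
  assumes "a \<cdot> b = c" "a \<in> Ar C" "b \<in> Ar C" "u \<in> Ar C" "Cod C b = Dom C a" "Cod C u = Dom C b"
  shows "a \<cdot> (b \<cdot> u) = c \<cdot> u"
  using Cmp_assoc[OF assms(4,3,2,6,5)] assms(1) by simp

text \<open>The uniqueness half of the universal property: equations between morphisms into a chosen
  fiber product are reduced to their two components.\<close>

lemma FP_cancel:
  assumes "f \<in> Ar C" "g \<in> Ar C" "Cod C g = Cod C f"
    and "u \<in> Ar C" "v \<in> Ar C" "Dom C u = Dom C v" "Cod C u = FP C f g" "Cod C v = FP C f g"
    and "P1 C f g \<cdot> u = P1 C f g \<cdot> v" "P2 C f g \<cdot> u = P2 C f g \<cdot> v"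
  shows "u = v"
  using fiber_square_cancel[OF fiber_product[OF assms(1,2) assms(3)[symmetric]]] assms by simp

lemma base_change_props:
  assumes "f \<in> Ar C" "g \<in> Ar C" "Cod C g = Cod C f" "h \<in> Ar C" "Cod C h = Dom C g"
  shows "base_change C f g h \<in> Ar C" "Dom C (base_change C f g h) = FP C f (g \<cdot> h)"
    "Cod C (base_change C f g h) = FP C f g"
    "P1 C f g \<cdot> base_change C f g h = P1 C f (g \<cdot> h)"
    "P2 C f g \<cdot> base_change C f g h = h \<cdot> P2 C f (g \<cdot> h)"
proof -
  have gh: "g \<cdot> h \<in> Ar C" "Cod C (g \<cdot> h) = Cod C f" "Dom C (g \<cdot> h) = Dom C h"
    using assms by (simp_all add: Cmp_simps)
  \<comment> \<open>The cone condition behind \<open>base_change\<close>: commutativity of the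
    square over \<open>g \<cdot> h\<close>, bracketed to the right.\<close>
  have eq: "f \<cdot> P1 C f (g \<cdot> h) = g \<cdot> (h \<cdot> P2 C f (g \<cdot> h))"
    using assms gh P1_P2_commute[OF assms(1) gh(1,2)] by (simp add: Cmp_simps)
  show "base_change C f g h \<in> Ar C" "Dom C (base_change C f g h) = FP C f (g \<cdot> h)"
    "Cod C (base_change C f g h) = FP C f g"
    "P1 C f g \<cdot> base_change C f g h = P1 C f (g \<cdot> h)"
    "P2 C f g \<cdot> base_change C f g h = h \<cdot> P2 C f (g \<cdot> h)"
    unfolding base_change_def
    using fiber_square_induced[OF fiber_product[OF assms(1,2) assms(3)[symmetric]] _ _ _ _ _ eq]
      assms gh by (simp_all add: Cmp_simps)
qed

lemma prod_comparison_props: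
  assumes "f \<in> Ar C" "g \<in> Ar C" "Cod C f = Dom C g" "h \<in> Ar C" "Cod C h = Cod C g"
  shows "prod_comparison C f g h \<in> Ar C"
    "Dom C (prod_comparison C f g h) = FP C f (P1 C g h)"
    "Cod C (prod_comparison C f g h) = FP C (g \<cdot> f) h"
    "P1 C (g \<cdot> f) h \<cdot> prod_comparison C f g h = P1 C f (P1 C g h)"
    "P2 C (g \<cdot> f) h \<cdot> prod_comparison C f g h = P2 C g h \<cdot> P2 C f (P1 C g h)"
proof -
  have gf: "g \<cdot> f \<in> Ar C" "Cod C (g \<cdot> f) = Cod C h" "Dom C (g \<cdot> f) = Dom C f"
    using assms by (simp_all add: Cmp_simps)
  have h: "h \<in> Over C g" using assms unfolding Over_def by simp
  \<comment> \<open>The legs of the iterated fiber product commute with \<open>g \<cdot> f\<close>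
    and \<open>h\<close>, hence form a cone for the chosen fiber product.\<close>
  note sq = fiber_square_prod[OF assms(1-3) h]
  note I = fiber_square_induced[OF fiber_product[OF gf(1) assms(4) gf(2)]
      fiber_squareD(1,2,5,6,7,9)[OF sq]]
  show "prod_comparison C f g h \<in> Ar C"
    "Dom C (prod_comparison C f g h) = FP C f (P1 C g h)"
    "Cod C (prod_comparison C f g h) = FP C (g \<cdot> f) h"
    "P1 C (g \<cdot> f) h \<cdot> prod_comparison C f g h = P1 C f (P1 C g h)"
    "P2 C (g \<cdot> f) h \<cdot> prod_comparison C f g h = P2 C g h \<cdot> P2 C f (P1 C g h)"
    unfolding prod_comparison_def using I assms gf by simp_all
qed

lemma push_comparison_props:
  assumes "f \<in> Ar C" "g \<in> Ar C" "Cod C f = Dom C g" "h \<in> Ar C" "Cod C h = Cod C g"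
  shows "push_comparison C f g h \<in> Ar C"
    "Dom C (push_comparison C f g h) = FP C (g \<cdot> f) h"
    "Cod C (push_comparison C f g h) = FP C g h"
    "P1 C g h \<cdot> push_comparison C f g h = f \<cdot> P1 C (g \<cdot> f) h"
    "P2 C g h \<cdot> push_comparison C f g h = P2 C (g \<cdot> f) h"
proof -
  have gf: "g \<cdot> f \<in> Ar C" "Cod C (g \<cdot> f) = Cod C g" "Dom C (g \<cdot> f) = Dom C f"
    using assms by (simp_all add: Cmp_simps)
  have eq: "g \<cdot> (f \<cdot> P1 C (g \<cdot> f) h) = h \<cdot> P2 C (g \<cdot> f) h"
    using P1_P2_commute[OF gf(1) assms(4)] assms gf
    by (simp add: Cmp_assoc[of "P1 C (g \<cdot> f) h" f g])
  show "push_comparison C f g h \<in> Ar C"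
    "Dom C (push_comparison C f g h) = FP C (g \<cdot> f) h"
    "Cod C (push_comparison C f g h) = FP C g h"
    "P1 C g h \<cdot> push_comparison C f g h = f \<cdot> P1 C (g \<cdot> f) h"
    "P2 C g h \<cdot> push_comparison C f g h = P2 C (g \<cdot> f) h"
    unfolding push_comparison_def
    using fiber_square_induced[OF fiber_product[OF assms(2,4) assms(5)[symmetric]] _ _ _ _ _ eq]
      assms gf by (simp_all add: Cmp_Ar Dom_Cmp Cod_Cmp)
qed

text \<open>Source and target are interchanged compared with \<open>prod_comparison\<close>: here
  the iterated fiber product is the target. The universal property is therefore that of the pasted
  square from \<open>fiber_square_pull\<close>, whose first leg is
  \<open>g' \<cdot> P1 C f' h\<close>.\<close>

lemma pull_comparison_props:
  assumes "fiber_square C g' f' f g" "h \<in> Ar C" "Cod C h = Cod C f'"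
  shows "pull_comparison C g' f' f g h \<in> Ar C"
    "Dom C (pull_comparison C g' f' f g h) = FP C f (g \<cdot> h)"
    "Cod C (pull_comparison C g' f' f g h) = FP C f' h"
    "g' \<cdot> (P1 C f' h \<cdot> pull_comparison C g' f' f g h) = P1 C f (g \<cdot> h)"
    "P2 C f' h \<cdot> pull_comparison C g' f' f g h = P2 C f (g \<cdot> h)"
proof -
  note D = fiber_squareD[OF assms(1)]
  have h: "h \<in> Over C f'" using assms unfolding Over_def by simp
  have gh: "g \<cdot> h \<in> Ar C" "Cod C (g \<cdot> h) = Cod C f" "Dom C (g \<cdot> h) = Dom C h"
    using assms D by (simp_all add: Cmp_simps)
  note sq = fiber_square_pull[OF assms(1) h]
  note E = fiber_squareD[OF fiber_product[OF D(3) gh(1) gh(2)[symmetric]]]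
  note I = fiber_square_induced[OF sq E(1,2,5,6,7,9), folded pull_comparison_def]
  show p: "pull_comparison C g' f' f g h \<in> Ar C"
    "Dom C (pull_comparison C g' f' f g h) = FP C f (g \<cdot> h)"
    "Cod C (pull_comparison C g' f' f g h) = FP C f' h"
    "P2 C f' h \<cdot> pull_comparison C g' f' f g h = P2 C f (g \<cdot> h)"
    using I D gh assms(2,3) by (simp_all add: Cmp_Ar Dom_Cmp Cod_Cmp)
  show "g' \<cdot> (P1 C f' h \<cdot> pull_comparison C g' f' f g h) = P1 C f (g \<cdot> h)"
    using I(4) p D assms(2,3) by (simp add: Cmp_simps)
qed

text \<open>Both sides have components \<open>P1 C f (P1 C g (h \<cdot> k))\<close> and \<open>k
  \<cdot> (P2 C g (h \<cdot> k) \<cdot> P2 C f (P1 C g (h \<cdot> k)))\<close>. On the iterated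
  fiber product \<open>k\<close> is base changed twice, first along \<open>g\<close> and then along
  \<open>f\<close>.\<close>

lemma prod_comparison_base_change:
  assumes "f \<in> Ar C" "g \<in> Ar C" "Cod C f = Dom C g" "h \<in> Ar C" "Cod C h = Cod C g"
    "k \<in> Ar C" "Cod C k = Dom C h"
  shows "base_change C (g \<cdot> f) h k \<cdot> prod_comparison C f g (h \<cdot> k) =
    prod_comparison C f g h \<cdot> base_change C f (P1 C g h) (base_change C g h k)"
proof -
  have gf: "g \<cdot> f \<in> Ar C" "Cod C (g \<cdot> f) = Cod C g" "Dom C (g \<cdot> f) = Dom C f"
    and hk: "h \<cdot> k \<in> Ar C" "Cod C (h \<cdot> k) = Cod C g" "Dom C (h \<cdot> k) = Dom C k"
    using assms by (simp_all add: Cmp_simps)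
  have P: "P1 C g h \<in> Ar C" "Cod C (P1 C g h) = Cod C f" "Dom C (P1 C g h) = FP C g h"
    using assms by simp_all
  note A = base_change_props[OF gf(1) assms(4) _ assms(6,7), unfolded gf, OF assms(5)]
    and B = base_change_props[OF assms(2,4,5,6,7)]
    and S = prod_comparison_props[OF assms(1,2,3,4,5)]
    and S' = prod_comparison_props[OF assms(1,2,3) hk(1,2)]
  \<comment> \<open>Unfolding \<open>B(4)\<close> makes the source of the double base change the
    fiber product over \<open>P1 C g (h \<cdot> k)\<close>, where
    \<open>prod_comparison C f g (h \<cdot> k)\<close> starts.\<close>
  note D = base_change_props[OF assms(1) P(1,2) B(1), unfolded P, OF B(3), unfolded B(4)]
  show ?thesis
    by (rule FP_cancel[OF gf(1) assms(4)])
      (use assms gf hk P A B S S' D in \<open>simp_all add: Cmp_Ar Dom_Cmp Cod_Cmp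
        Cmp_reassoc[OF A(4)] Cmp_reassoc[OF A(5)] Cmp_reassoc[OF S(4)] Cmp_reassoc[OF S(5)]
        Cmp_reassoc[OF B(5)] Cmp_assoc\<close>)
qed

text \<open>Both sides have components \<open>f \<cdot> P1 C (g \<cdot> f) (h \<cdot> k)\<close> and
  \<open>k \<cdot> P2 C (g \<cdot> f) (h \<cdot> k)\<close>.\<close>

lemma push_comparison_base_change:
  assumes "f \<in> Ar C" "g \<in> Ar C" "Cod C f = Dom C g" "h \<in> Ar C" "Cod C h = Cod C g"
    "k \<in> Ar C" "Cod C k = Dom C h"
  shows "base_change C g h k \<cdot> push_comparison C f g (h \<cdot> k) =
    push_comparison C f g h \<cdot> base_change C (g \<cdot> f) h k"
proof -
  have gf: "g \<cdot> f \<in> Ar C" "Cod C (g \<cdot> f) = Cod C g" "Dom C (g \<cdot> f) = Dom C f"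
    and hk: "h \<cdot> k \<in> Ar C" "Cod C (h \<cdot> k) = Cod C g" "Dom C (h \<cdot> k) = Dom C k"
    using assms by (simp_all add: Cmp_simps)
  note A = base_change_props[OF gf(1) assms(4) _ assms(6,7), unfolded gf, OF assms(5)]
    and B = base_change_props[OF assms(2,4,5,6,7)]
    and S = push_comparison_props[OF assms(1,2,3,4,5)]
    and S' = push_comparison_props[OF assms(1,2,3) hk(1,2)]
  show ?thesis
    by (rule FP_cancel[OF assms(2,4,5)])
      (use assms gf hk A B S S' in \<open>simp_all add: Cmp_Ar Dom_Cmp Cod_Cmp
        Cmp_reassoc[OF B(4)] Cmp_reassoc[OF B(5)] Cmp_reassoc[OF S(4)] Cmp_reassoc[OF S(5)]
        Cmp_assoc[of _ _ k] Cmp_assoc[of _ _ f]\<close>)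
qed

lemma pull_comparison_base_change:
  assumes "fiber_square C g' f' f g" "h \<in> Ar C" "Cod C h = Cod C f'" "k \<in> Ar C" "Cod C k = Dom C h"
  shows "base_change C f' h k \<cdot> pull_comparison C g' f' f g (h \<cdot> k) =
    pull_comparison C g' f' f g h \<cdot> base_change C f (g \<cdot> h) k"
proof -
  note D = fiber_squareD[OF assms(1)]
  have gh: "g \<cdot> h \<in> Ar C" "Cod C (g \<cdot> h) = Cod C f" "Dom C (g \<cdot> h) = Dom C h"
    and hk: "h \<cdot> k \<in> Ar C" "Cod C (h \<cdot> k) = Cod C f'" "Dom C (h \<cdot> k) = Dom C k"
    and ghk: "(g \<cdot> h) \<cdot> k = g \<cdot> (h \<cdot> k)"
    using assms D by (simp_all add: Cmp_simps)
  \<comment> \<open>Chosen fiber products depend on the morphism itself, so the two bracketings of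
    \<open>g\<close>, \<open>h\<close>, \<open>k\<close> are identified by \<open>ghk\<close>
    first.\<close>
  note A = base_change_props[OF D(3) gh(1,2) assms(4), unfolded gh ghk, OF assms(5)]
    and B = base_change_props[OF D(2) assms(2,3,4,5)]
    and S = pull_comparison_props[OF assms(1,2,3)]
    and S' = pull_comparison_props[OF assms(1) hk(1,2)]
  have h: "h \<in> Over C f'" using assms(2,3) unfolding Over_def by simp
  note sq = fiber_square_pull[OF assms(1) h]
  \<comment> \<open>Here the projection equation has three factors on the left, so
    \<open>Cmp_reassoc\<close> does not match its right-bracketed form; this is the version with a
    tail \<open>u\<close>.\<close>
  have S4: "g' \<cdot> (P1 C f' h \<cdot> (pull_comparison C g' f' f g h \<cdot> u)) = P1 C f (g \<cdot> h) \<cdot> u"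
    if "u \<in> Ar C" "Cod C u = FP C f (g \<cdot> h)" for u
    using that S(1-3) S(4)[symmetric] assms(2,3) D by (simp add: Cmp_simps)
  show ?thesis
    by (rule fiber_square_cancel[OF sq])
      (use assms gh hk A B S S' S4 D in \<open>simp_all add: Cmp_Ar Dom_Cmp Cod_Cmp
        Cmp_reassoc[OF B(4)] Cmp_reassoc[OF B(5)] Cmp_reassoc[OF S(5)]
        Cmp_assoc\<close>)
qed

end

section \<open>Closure of the co-operational theory under product, pushforward and pullback\<close>

locale coop_category = fp_category C + contravariant_functor C F
  for C :: "('o, 'a) category_data" (structure) and F :: "('o, 'a, 'v) functor_data"
begin

lemma Pb_value:
  assumes "h \<in> Ar C" "x \<in> Val F (Cod C h) m"
  shows "Pb F h m x \<in> Val F (Dom C h) m"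
  using Pb_in[OF assms(1)] assms(2) by blast

text \<open>The base change of \<open>k\<close> is moved in three stages: past the comparison
  isomorphism, then past \<open>c\<close> as a base change along \<open>base_change C g h k\<close>,
  and finally past \<open>d\<close> along \<open>k\<close> itself.\<close>

lemma coop_prod_closed:
  assumes "f \<in> Ar C" "g \<in> Ar C" "Cod C f = Dom C g"
    and c: "c \<in> coop C F i f" and d: "d \<in> coop C F j g"
  shows "coop_prod C F i f g c d \<in> coop C F (i + j) (g \<cdot> f)"
proof -
  have gf: "Cod C (g \<cdot> f) = Cod C g" "Over C (g \<cdot> f) = Over C g"
    using assms by (simp_all add: Cod_Cmp Over_def)
  \<comment> \<open>Functor laws and class conditions hold only on the sets \<open>Val\<close>, so
    every intermediate value must be located there.\<close>
  have typed: "Pb F (prod_comparison C f g h) m x \<in> Val F (FP C f (P1 C g h)) m"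
    "c (P1 C g h) m (Pb F (prod_comparison C f g h) m x) \<in> Val F (FP C g h) (m + i)"
    "coop_prod C F i f g c d h m x \<in> Val F (Dom C h) (m + (i + j))"
    if h: "h \<in> Over C g" and x: "x \<in> Val F (FP C (g \<cdot> f) h) m" for h m x
  proof -
    have h': "h \<in> Ar C" "Cod C h = Cod C g" using h unfolding Over_def by auto
    have P: "P1 C g h \<in> Over C f" using assms h' unfolding Over_def by simp
    note S = prod_comparison_props[OF assms(1,2,3) h']
    show 1: "Pb F (prod_comparison C f g h) m x \<in> Val F (FP C f (P1 C g h)) m"
      using Pb_value[OF S(1)] S(2,3) x by simp
    show 2: "c (P1 C g h) m (Pb F (prod_comparison C f g h) m x) \<in> Val F (FP C g h) (m + i)"
      using coop_value[OF c P 1] assms h' by simp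
    show "coop_prod C F i f g c d h m x \<in> Val F (Dom C h) (m + (i + j))"
      using coop_value[OF d h 2] coop_prod_apply[OF h x] by (simp add: add.assoc)
  qed
  show ?thesis
  proof (rule coopI)
    show "coop_prod C F i f g c d \<in> (\<Pi>\<^sub>E h\<in>Over C (g \<cdot> f). \<Pi>\<^sub>E m\<in>UNIV.
        Val F (FP C (g \<cdot> f) h) m \<rightarrow>\<^sub>E Val F (Dom C h) (m + (i + j)))"
      using typed(3) unfolding gf coop_prod_def by (intro PiE_I) auto
    fix h k m x
    assume h: "h \<in> Over C (g \<cdot> f)" and k: "k \<in> Ar C" "Cod C k = Dom C h"
      and x: "x \<in> Val F (FP C (g \<cdot> f) h) m"
    have h': "h \<in> Over C g" "h \<in> Ar C" "Cod C h = Cod C g"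
      using h unfolding gf Over_def by auto
    have hk: "h \<cdot> k \<in> Over C g" "h \<cdot> k \<in> Ar C" "Cod C (h \<cdot> k) = Cod C g"
      using h' k unfolding Over_def by (simp_all add: Cmp_simps)
    have gf': "g \<cdot> f \<in> Ar C" using Cmp_Ar[OF assms(1-3)] .
    have P: "P1 C g h \<in> Over C f" "Dom C (P1 C g h) = FP C g h"
      using assms h' unfolding Over_def by simp_all
    have P': "P1 C g h \<in> Ar C" "Cod C (P1 C g h) = Cod C f" using P(1) unfolding Over_def by auto
    note A = base_change_props[OF gf' h'(2) _ k, unfolded gf, OF h'(3)]
      and B = base_change_props[OF assms(2) h'(2,3) k]
      and S = prod_comparison_props[OF assms(1,2,3) h'(2,3)]
      and S' = prod_comparison_props[OF assms(1,2,3) hk(2,3)]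
    note D = base_change_props[OF assms(1) P' B(1), unfolded P(2), OF B(3)]
    define y where "y = Pb F (prod_comparison C f g h) m x"
    note y = typed(1,2)[OF h'(1) x, folded y_def]
    have "Pb F (prod_comparison C f g (h \<cdot> k)) m (Pb F (base_change C (g \<cdot> f) h k) m x)
        = Pb F (base_change C (g \<cdot> f) h k \<cdot> prod_comparison C f g (h \<cdot> k)) m x"
      using Pb_Cmp[OF S'(1) A(1)] S'(3) A(2,3) x by simp
    also have "\<dots> = Pb F (base_change C f (P1 C g h) (base_change C g h k)) m y"
      unfolding prod_comparison_base_change[OF assms(1,2,3) h'(2,3) k] y_def
      using Pb_Cmp[OF D(1) S(1)] S(2,3) D(3) x by simp
    \<comment> \<open>\<open>B(4)\<close> identifies \<open>P1 C g (h \<cdot> k)\<close>, where the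
      product formula evaluates \<open>c\<close>, with the composite to which the compatibility of
      \<open>c\<close> applies.\<close>
    finally have "coop_prod C F i f g c d (h \<cdot> k) m (Pb F (base_change C (g \<cdot> f) h k) m x)
        = d (h \<cdot> k) (m + i) (c (P1 C g h \<cdot> base_change C g h k) m
            (Pb F (base_change C f (P1 C g h) (base_change C g h k)) m y))"
      using coop_prod_apply[OF hk(1), where F = F] Pb_value[OF A(1)] A(2,3) x B(4) by simp
    also have "\<dots> = d (h \<cdot> k) (m + i) (Pb F (base_change C g h k) (m + i) (c (P1 C g h) m y))"
      using coop_base_change[OF c P(1) B(1) _ y(1)] B(3) P(2) by simp
    also have "\<dots> = Pb F k (m + i + j) (d h (m + i) (c (P1 C g h) m y))"
      by (rule coop_base_change[OF d h'(1) k y(2)])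
    finally show "coop_prod C F i f g c d (h \<cdot> k) m (Pb F (base_change C (g \<cdot> f) h k) m x)
        = Pb F k (m + (i + j)) (coop_prod C F i f g c d h m x)"
      using coop_prod_apply[OF h'(1) x] unfolding y_def by (simp add: add.assoc)
  qed
qed

text \<open>Base change commutes with \<open>f'\<close>, so pulling back along \<open>f'\<close>
  carries the arguments of the new class to those of \<open>c\<close>, where compatibility is
  known.\<close>

lemma coop_push_closed:
  assumes "f \<in> Ar C" "g \<in> Ar C" "Cod C f = Dom C g" and c: "c \<in> coop C F i (g \<cdot> f)"
  shows "coop_push C F f g c \<in> coop C F i g"
proof -
  have gf: "g \<cdot> f \<in> Ar C" "Cod C (g \<cdot> f) = Cod C g" "Over C (g \<cdot> f) = Over C g"
    using assms by (simp_all add: Cmp_simps Over_def)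
  have typed: "Pb F (push_comparison C f g h) m x \<in> Val F (FP C (g \<cdot> f) h) m"
    "coop_push C F f g c h m x \<in> Val F (Dom C h) (m + i)"
    if h: "h \<in> Over C g" and x: "x \<in> Val F (FP C g h) m" for h m x
  proof -
    have h': "h \<in> Ar C" "Cod C h = Cod C g" using h unfolding Over_def by auto
    note S = push_comparison_props[OF assms(1,2,3) h']
    show 1: "Pb F (push_comparison C f g h) m x \<in> Val F (FP C (g \<cdot> f) h) m"
      using Pb_value[OF S(1)] S(2,3) x by simp
    show "coop_push C F f g c h m x \<in> Val F (Dom C h) (m + i)"
      using coop_value[OF c _ 1] coop_push_apply[OF h x] h gf(3) by simp
  qed
  show ?thesis
  proof (rule coopI)
    show "coop_push C F f g c \<in> (\<Pi>\<^sub>E h\<in>Over C g. \<Pi>\<^sub>E m\<in>UNIV.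
        Val F (FP C g h) m \<rightarrow>\<^sub>E Val F (Dom C h) (m + i))"
      using typed(2) unfolding coop_push_def by (intro PiE_I) auto
    fix h k m x
    assume h: "h \<in> Over C g" and k: "k \<in> Ar C" "Cod C k = Dom C h"
      and x: "x \<in> Val F (FP C g h) m"
    have h': "h \<in> Over C (g \<cdot> f)" "h \<in> Ar C" "Cod C h = Cod C g"
      using h unfolding gf Over_def by auto
    have hk: "h \<cdot> k \<in> Over C g" "h \<cdot> k \<in> Ar C" "Cod C (h \<cdot> k) = Cod C g"
      using h' k unfolding Over_def by (simp_all add: Cmp_simps)
    note A = base_change_props[OF gf(1) h'(2) _ k, unfolded gf, OF h'(3)]
      and B = base_change_props[OF assms(2) h'(2,3) k]
      and S = push_comparison_props[OF assms(1,2,3) h'(2,3)]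
      and S' = push_comparison_props[OF assms(1,2,3) hk(2,3)]
    have "Pb F (push_comparison C f g (h \<cdot> k)) m (Pb F (base_change C g h k) m x)
        = Pb F (base_change C g h k \<cdot> push_comparison C f g (h \<cdot> k)) m x"
      using Pb_Cmp[OF S'(1) B(1)] S'(3) B(2,3) x by simp
    also have "\<dots> = Pb F (base_change C (g \<cdot> f) h k) m (Pb F (push_comparison C f g h) m x)"
      unfolding push_comparison_base_change[OF assms(1,2,3) h'(2,3) k]
      using Pb_Cmp[OF A(1) S(1)] S(2,3) A(3) x by simp
    finally show "coop_push C F f g c (h \<cdot> k) m (Pb F (base_change C g h k) m x)
        = Pb F k (m + i) (coop_push C F f g c h m x)"
      using coop_push_apply[OF hk(1), where F = F] Pb_value[OF B(1)] B(2,3) x coop_push_apply[OF h x]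
        coop_base_change[OF c h'(1) k typed(1)[OF h x]] by simp
  qed
qed

text \<open>Up to the comparison isomorphism, compatibility of the new class at \<open>h\<close> and
  \<open>k\<close> is that of \<open>c\<close> at \<open>g \<cdot> h\<close> and
  \<open>k\<close>.\<close>

lemma coop_pull_closed:
  assumes sq: "fiber_square C g' f' f g" and c: "c \<in> coop C F i f"
  shows "coop_pull C F g' f' f g c \<in> coop C F i f'"
proof -
  note D = fiber_squareD[OF sq]
  have Over_Cmp: "g \<cdot> h \<in> Over C f" "Dom C (g \<cdot> h) = Dom C h" if "h \<in> Over C f'" for h
    using that D unfolding Over_def by (simp_all add: Cmp_simps)
  have typed: "Pb F (pull_comparison C g' f' f g h) m x \<in> Val F (FP C f (g \<cdot> h)) m"
    "coop_pull C F g' f' f g c h m x \<in> Val F (Dom C h) (m + i)"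
    if h: "h \<in> Over C f'" and x: "x \<in> Val F (FP C f' h) m" for h m x
  proof -
    have h': "h \<in> Ar C" "Cod C h = Cod C f'" using h unfolding Over_def by auto
    note S = pull_comparison_props[OF sq h']
    show 1: "Pb F (pull_comparison C g' f' f g h) m x \<in> Val F (FP C f (g \<cdot> h)) m"
      using Pb_value[OF S(1)] S(2,3) x by simp
    show "coop_pull C F g' f' f g c h m x \<in> Val F (Dom C h) (m + i)"
      using coop_value[OF c Over_Cmp(1)[OF h] 1] coop_pull_apply[OF h x] Over_Cmp(2)[OF h] by simp
  qed
  show ?thesis
  proof (rule coopI)
    show "coop_pull C F g' f' f g c \<in> (\<Pi>\<^sub>E h\<in>Over C f'. \<Pi>\<^sub>E m\<in>UNIV.
        Val F (FP C f' h) m \<rightarrow>\<^sub>E Val F (Dom C h) (m + i))"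
      using typed(2) unfolding coop_pull_def by (intro PiE_I) auto
    fix h k m x
    assume h: "h \<in> Over C f'" and k: "k \<in> Ar C" "Cod C k = Dom C h"
      and x: "x \<in> Val F (FP C f' h) m"
    have h': "h \<in> Ar C" "Cod C h = Cod C f'" using h unfolding Over_def by auto
    have hk: "h \<cdot> k \<in> Over C f'" "h \<cdot> k \<in> Ar C" "Cod C (h \<cdot> k) = Cod C f'"
      using h' k unfolding Over_def by (simp_all add: Cmp_simps)
    have gh: "g \<cdot> h \<in> Ar C" "Cod C (g \<cdot> h) = Cod C f" "Cod C k = Dom C (g \<cdot> h)"
      using Over_Cmp[OF h] k unfolding Over_def by auto
    have ghk: "(g \<cdot> h) \<cdot> k = g \<cdot> (h \<cdot> k)" using h' k D by (simp add: Cmp_simps)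
    note A = base_change_props[OF D(3) gh(1,2) k(1) gh(3)]
      and B = base_change_props[OF D(2) h' k]
      and S = pull_comparison_props[OF sq h']
      and S' = pull_comparison_props[OF sq hk(2,3)]
    have "Pb F (pull_comparison C g' f' f g (h \<cdot> k)) m (Pb F (base_change C f' h k) m x)
        = Pb F (base_change C f' h k \<cdot> pull_comparison C g' f' f g (h \<cdot> k)) m x"
      using Pb_Cmp[OF S'(1) B(1)] S'(3) B(2,3) x by simp
    also have "\<dots> = Pb F (base_change C f (g \<cdot> h) k) m (Pb F (pull_comparison C g' f' f g h) m x)"
      unfolding pull_comparison_base_change[OF sq h' k]
      using Pb_Cmp[OF A(1) S(1)] S(2,3) A(3) x by simp
    finally show "coop_pull C F g' f' f g c (h \<cdot> k) m (Pb F (base_change C f' h k) m x)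
        = Pb F k (m + i) (coop_pull C F g' f' f g c h m x)"
      using coop_pull_apply[OF hk(1), where F = F] Pb_value[OF B(1)] B(2,3) x coop_pull_apply[OF h x]
        coop_base_change[OF c Over_Cmp(1)[OF h] k(1) gh(3) typed(1)[OF h x]] ghk by simp
  qed
qed

lemma coop_theory_closed: "closed_operations C (coop_theory C F)"
  unfolding closed_operations_def coop_theory_def
  by (simp add: coop_prod_closed coop_push_closed coop_pull_closed)

end

section \<open>Intertwining by a natural transformation and the subtheory it defines\<close>

locale coop_transformation = F: coop_category C F + G: coop_category C G
  for C :: "('o, 'a) category_data" (structure)
    and F :: "('o, 'a, 'v) functor_data" and G :: "('o, 'a, 'w) functor_data" +
  fixes T :: "'o \<Rightarrow> int \<Rightarrow> 'v \<Rightarrow> 'w"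
  assumes natural: "natural_transformation C F G T"
begin

lemma T_value:
  assumes "X \<in> Ob C" "x \<in> Val F X m"
  shows "T X m x \<in> Val G X m"
  using natural assms unfolding natural_transformation_def by blast

lemma T_Pb:
  assumes "h \<in> Ar C" "x \<in> Val F (Cod C h) m"
  shows "T (Dom C h) m (Pb F h m x) = Pb G h m (T (Cod C h) m x)"
  using natural assms unfolding natural_transformation_def by blast

text \<open>The operations over \<open>G\<close> are restricted functions; this places
  \<open>T x\<close> in the domain where their defining formulas apply.\<close>

lemma T_FP_value:
  assumes "f \<in> Ar C" "g \<in> Over C f" "x \<in> Val F (FP C f g) m"
  shows "T (FP C f g) m x \<in> Val G (FP C f g) m"
proof -
  have "P1 C f g \<in> Ar C" using assms(1,2) unfolding Over_def by simp
  then show ?thesis using T_value[OF F.Dom_Ob] assms(3) unfolding FP_def by blast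
qed

lemma intertwinesD:
  assumes "intertwines C F T i f c c'" "g \<in> Over C f" "x \<in> Val F (FP C f g) m"
  shows "T (Dom C g) (m + i) (c g m x) = c' g m (T (FP C f g) m x)"
  using assms unfolding intertwines_def by blast

text \<open>Naturality moves \<open>T\<close> past the comparison pullback, then \<open>cc'\<close>
  past \<open>c\<close> and \<open>dd'\<close> past \<open>d\<close>. Membership of \<open>c\<close>
  in \<open>coop\<close> ensures that its value lies where \<open>dd'\<close> speaks about
  \<open>d\<close>.\<close>

lemma intertwines_prod:
  assumes "f \<in> Ar C" "g \<in> Ar C" "Cod C f = Dom C g" and c: "c \<in> coop C F i f"
    and cc': "intertwines C F T i f c c'" and dd': "intertwines C F T j g d d'"
  shows "intertwines C F T (i + j) (g \<cdot> f) (coop_prod C F i f g c d) (coop_prod C G i f g c' d')"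
  unfolding intertwines_def
proof (intro ballI allI)
  fix h m x
  assume "h \<in> Over C (g \<cdot> f)" and x: "x \<in> Val F (FP C (g \<cdot> f) h) m"
  then have h: "h \<in> Over C g" "h \<in> Ar C" "Cod C h = Cod C g" and h': "h \<in> Over C (g \<cdot> f)"
    using assms unfolding Over_def by (simp_all add: F.Cod_Cmp)
  have P: "P1 C g h \<in> Over C f" "Dom C (P1 C g h) = FP C g h"
    using assms h unfolding Over_def by simp_all
  note S = F.prod_comparison_props[OF assms(1,2,3) h(2,3)]
  define y where "y = Pb F (prod_comparison C f g h) m x"
  have y: "y \<in> Val F (FP C f (P1 C g h)) m"
    using F.Pb_value[OF S(1)] S(2,3) x unfolding y_def by simp
  have Ty: "T (FP C f (P1 C g h)) m y = Pb G (prod_comparison C f g h) m (T (FP C (g \<cdot> f) h) m x)"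
    using T_Pb[OF S(1)] S(2,3) x unfolding y_def by simp
  have z: "c (P1 C g h) m y \<in> Val F (FP C g h) (m + i)"
    using coop_value[OF c P(1) y] P(2) by simp
  have "T (Dom C h) (m + i + j) (d h (m + i) (c (P1 C g h) m y))
      = d' h (m + i) (T (FP C g h) (m + i) (c (P1 C g h) m y))"
    by (rule intertwinesD[OF dd' h(1) z])
  also have "\<dots> = d' h (m + i) (c' (P1 C g h) m (T (FP C f (P1 C g h)) m y))"
    using intertwinesD[OF cc' P(1) y] P(2) by simp
  finally show "T (Dom C h) (m + (i + j)) (coop_prod C F i f g c d h m x)
      = coop_prod C G i f g c' d' h m (T (FP C (g \<cdot> f) h) m x)"
    using coop_prod_apply[OF h(1) x] Ty T_FP_value[OF F.Cmp_Ar[OF assms(1-3)] h' x]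
    unfolding y_def by (simp add: coop_prod_apply[OF h(1)] add.assoc)
qed

lemma intertwines_push:
  assumes "f \<in> Ar C" "g \<in> Ar C" "Cod C f = Dom C g" and cc': "intertwines C F T i (g \<cdot> f) c c'"
  shows "intertwines C F T i g (coop_push C F f g c) (coop_push C G f g c')"
  unfolding intertwines_def
proof (intro ballI allI)
  fix h m x
  assume h: "h \<in> Over C g" and x: "x \<in> Val F (FP C g h) m"
  then have h': "h \<in> Over C (g \<cdot> f)" "h \<in> Ar C" "Cod C h = Cod C g"
    using assms unfolding Over_def by (simp_all add: F.Cod_Cmp)
  note S = F.push_comparison_props[OF assms(1,2,3) h'(2,3)]
  have y: "Pb F (push_comparison C f g h) m x \<in> Val F (FP C (g \<cdot> f) h) m"
    using F.Pb_value[OF S(1)] S(2,3) x by simp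
  show "T (Dom C h) (m + i) (coop_push C F f g c h m x)
      = coop_push C G f g c' h m (T (FP C g h) m x)"
    using intertwinesD[OF cc' h'(1) y] T_Pb[OF S(1)] S(2,3) x coop_push_apply[OF h x]
      coop_push_apply[OF h T_FP_value[OF assms(2) h x]] by simp
qed

text \<open>Naturality is used at the comparison isomorphism and \<open>cc'\<close> at
  \<open>g \<cdot> h\<close>, which has the same domain as \<open>h\<close>.\<close>

lemma intertwines_pull:
  assumes sq: "fiber_square C g' f' f g" and cc': "intertwines C F T i f c c'"
  shows "intertwines C F T i f' (coop_pull C F g' f' f g c) (coop_pull C G g' f' f g c')"
  unfolding intertwines_def
proof (intro ballI allI)
  note D = F.fiber_squareD[OF sq]
  fix h m x
  assume h: "h \<in> Over C f'" and x: "x \<in> Val F (FP C f' h) m"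
  then have h': "h \<in> Ar C" "Cod C h = Cod C f'" unfolding Over_def by auto
  have gh: "g \<cdot> h \<in> Over C f" "Dom C (g \<cdot> h) = Dom C h"
    using h' D unfolding Over_def by (simp_all add: F.Cmp_simps)
  note S = F.pull_comparison_props[OF sq h']
  have y: "Pb F (pull_comparison C g' f' f g h) m x \<in> Val F (FP C f (g \<cdot> h)) m"
    using F.Pb_value[OF S(1)] S(2,3) x by simp
  show "T (Dom C h) (m + i) (coop_pull C F g' f' f g c h m x)
      = coop_pull C G g' f' f g c' h m (T (FP C f' h) m x)"
    using intertwinesD[OF cc' gh(1) y] T_Pb[OF S(1)] S(2,3) x coop_pull_apply[OF h x] gh(2)
      coop_pull_apply[OF h T_FP_value[OF D(2) h x]] by simp
qed

lemma coop_subE: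
  assumes "c \<in> coop_sub C F G T i f"
  obtains c' where "c \<in> coop C F i f" "c' \<in> coop C G i f" "intertwines C F T i f c c'"
  using assms unfolding coop_sub_def by blast

lemma coop_subI:
  assumes "c \<in> coop C F i f" "c' \<in> coop C G i f" "intertwines C F T i f c c'"
  shows "c \<in> coop_sub C F G T i f"
  using assms unfolding coop_sub_def by blast

text \<open>The product of any witnesses over \<open>G\<close> for the factors is a witness for the
  product; pushforward and pullback below follow the same pattern, independently of a choice
  \<open>cT\<close>.\<close>

lemma coop_sub_prod_closed:
  assumes fg: "f \<in> Ar C" "g \<in> Ar C" "Cod C f = Dom C g"
    and c: "c \<in> coop_sub C F G T i f" and d: "d \<in> coop_sub C F G T j g"
  shows "coop_prod C F i f g c d \<in> coop_sub C F G T (i + j) (g \<cdot> f)"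
  by (rule coop_subE[OF c], rule coop_subE[OF d])
    (rule coop_subI[OF F.coop_prod_closed[OF fg] G.coop_prod_closed[OF fg] intertwines_prod[OF fg]])

lemma coop_sub_push_closed:
  assumes fg: "f \<in> Ar C" "g \<in> Ar C" "Cod C f = Dom C g" and c: "c \<in> coop_sub C F G T i (g \<cdot> f)"
  shows "coop_push C F f g c \<in> coop_sub C F G T i g"
  by (rule coop_subE[OF c])
    (rule coop_subI[OF F.coop_push_closed[OF fg] G.coop_push_closed[OF fg] intertwines_push[OF fg]])

lemma coop_sub_pull_closed:
  assumes sq: "fiber_square C g' f' f g" and c: "c \<in> coop_sub C F G T i f"
  shows "coop_pull C F g' f' f g c \<in> coop_sub C F G T i f'"
  by (rule coop_subE[OF c])
    (rule coop_subI[OF F.coop_pull_closed[OF sq] G.coop_pull_closed[OF sq] intertwines_pull[OF sq]])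

lemma coop_sub_theory_closed: "closed_operations C (coop_sub_theory C F G T)"
  unfolding closed_operations_def coop_sub_theory_def coop_theory_def
  by (simp add: coop_sub_prod_closed coop_sub_push_closed coop_sub_pull_closed)

section \<open>Surjective transformations and the Grothendieck transformation\<close>

lemma intertwines_unique:
  assumes surj: "surjective_transformation C F G T" and f: "f \<in> Ar C"
    and c': "c' \<in> coop C G i f" "c'' \<in> coop C G i f"
    and cc': "intertwines C F T i f c c'" "intertwines C F T i f c c''"
  shows "c' = c''"
proof (rule coop_ext[OF c'])
  fix g m y
  assume g: "g \<in> Over C f" and y: "y \<in> Val G (FP C f g) m"
  have "P1 C f g \<in> Ar C" using f g unfolding Over_def by simp
  then have "FP C f g \<in> Ob C" unfolding FP_def by (rule F.Dom_Ob)
  \<comment> \<open>By surjectivity every argument over \<open>G\<close> is some \<open>T x\<close>,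
    and there both candidates take the value of \<open>T\<close> at \<open>c g m x\<close>.\<close>
  then obtain x where "x \<in> Val F (FP C f g) m" "y = T (FP C f g) m x"
    using surj y unfolding surjective_transformation_def by blast
  then show "c' g m y = c'' g m y"
    using intertwinesD[OF cc'(1) g] intertwinesD[OF cc'(2) g] by metis
qed

text \<open>In each identity both sides intertwine with the same class over \<open>F\<close>: the
  left as its chosen element, the right because the operations preserve intertwining. Uniqueness
  then identifies them.\<close>

lemma surjective_choice:
  assumes surj: "surjective_transformation C F G T" and cT: "associated_choice C F G T cT"
  shows "choice_prod C F G T cT" "choice_push C F G T cT" "choice_pull C F G T cT"
proof -
  have cT: "cT i f c \<in> coop C G i f" "intertwines C F T i f c (cT i f c)"
    if "f \<in> Ar C" "c \<in> coop_sub C F G T i f" for i f c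
    using cT that unfolding associated_choice_def by blast+
  have unique: "cT i f c = c'"
    if "f \<in> Ar C" "c \<in> coop_sub C F G T i f" "c' \<in> coop C G i f" "intertwines C F T i f c c'"
    for i f c c'
    using intertwines_unique[OF surj that(1) cT(1)[OF that(1,2)] that(3) cT(2)[OF that(1,2)] that(4)] .
  have sub: "c \<in> coop C F i f" if "c \<in> coop_sub C F G T i f" for i f c
    using that unfolding coop_sub_def by blast
  show "choice_prod C F G T cT"
    unfolding choice_prod_def
    by (intro ballI impI allI unique F.Cmp_Ar coop_sub_prod_closed G.coop_prod_closed
        intertwines_prod cT sub)
  show "choice_push C F G T cT"
    unfolding choice_push_def
    by (intro ballI impI allI unique F.Cmp_Ar coop_sub_push_closed G.coop_push_closed
        intertwines_push cT)
  show "choice_pull C F G T cT"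
    unfolding choice_pull_def
    by (intro ballI impI allI unique coop_sub_pull_closed G.coop_pull_closed
        intertwines_pull cT) (auto dest: F.fiber_squareD)
qed

text \<open>The choice \<open>cT\<close> itself is the transformation:
  \<open>associated_choice\<close> gives its typing, the three choice conditions are the
  preservation laws, and the closure results cover the rest.\<close>

lemma choice_grothendieck_transformation:
  assumes "associated_choice C F G T cT" "choice_prod C F G T cT" "choice_push C F G T cT"
    "choice_pull C F G T cT"
  shows "grothendieck_transformation C (coop_sub_theory C F G T) (coop_theory C G) cT"
  using assms coop_sub_theory_closed G.coop_theory_closed
  unfolding grothendieck_transformation_def associated_choice_def choice_prod_def choice_push_def
    choice_pull_def coop_sub_theory_def coop_theory_def by simp

end

theorem corollary4p35:
  fixes C :: "('o, 'a) category_data"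
    and F :: "('o, 'a, 'v) functor_data"
    and G :: "('o, 'a, 'w) functor_data"
    and T :: "'o \<Rightarrow> int \<Rightarrow> 'v \<Rightarrow> 'w"
    and cT :: "int \<Rightarrow> 'a \<Rightarrow> ('a, 'v) coop_class \<Rightarrow> ('a, 'w) coop_class"
  assumes "fp_category C"
    and "contravariant_functor C F"
    and "contravariant_functor C G"
    and "natural_transformation C F G T"
    and "associated_choice C F G T cT"
  shows "(surjective_transformation C F G T \<longrightarrow>
            choice_prod C F G T cT \<and> choice_push C F G T cT \<and> choice_pull C F G T cT) \<and>
         (choice_prod C F G T cT \<and> choice_push C F G T cT \<and> choice_pull C F G T cT \<longrightarrow>
            (\<exists>\<gamma>. grothendieck_transformation C (coop_sub_theory C F G T) (coop_theory C G) \<gamma> \<and>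
               (\<forall>f\<in>Ar C. \<forall>i. \<forall>c\<in>coop_sub C F G T i f.
                  \<gamma> i f c = cT i f c \<and>
                  (\<forall>g\<in>Over C f. \<forall>m. \<forall>x\<in>Val F (FP C f g) m.
                     T (Dom C g) (m + i) (c g m x) = \<gamma> i f c g m (T (FP C f g) m x)))))"
proof -
  interpret coop_transformation C F G T
    using assms(1-4)
    by (simp add: coop_transformation_def coop_category_def coop_transformation_axioms_def)
  \<comment> \<open>The witness for \<open>\<gamma>\<close> is \<open>cT\<close>, and the last
    equation is the intertwining part of \<open>associated_choice\<close>.\<close>
  show ?thesis
    using surjective_choice[OF _ assms(5)] choice_grothendieck_transformation[OF assms(5)] assms(5)
    unfolding associated_choice_def intertwines_def by blast
qed

end
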